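(* Let $\delta=f(x)D_{d,P}$, where $f(x)=\sum_{i=0}^{l}a_ix^{n_i}\in k[x]$ with $l\in\mathbb{N}\cup\{0\}$, $n_0,\dots,n_l\in\mathbb{N}\cup\{0\}$ pairwise distinct and $a_i\in k^*$ for each $i$. Put $\mathbb{G}:=\mathrm{Aut}(\delta)$ and $n:=\gcd(d+n_0,\dots,d+n_l)$. Then the following statements hold. (i) The unipotent group $\mathbb{U}\subseteq\mathbb{G}$, and hence $\mathbb{U}_\delta=\mathbb{U}$. (ii) If $a\in k^*$ with $a^q\neq 1$ for any $q\in\{1,\dots,d-1\}$, then $H_a\in\mathbb{G}$ if and only if $a^n=1$ and $n\geqslant d$. (iii) If $a\in k^*$ with $a^{q_0}=1$ for some minimal $q_0\in\{2,\dots,d-1\}$, then $H_{a,q_0}\in\mathbb{G}$ if and only if $q_0\mid n$. (iv) If $k$ is algebraically closed, then $\mathbb{H}_\delta\cong\mathbb{Z}_n$ (the cyclic group of order $n$). Moreover, if $n\geqslant d$, then the generators of $\mathbb{H}_\delta$ are of the form $H_a$, where $a$ is a primitive $n$-th root of unity. Otherwise, they are of the form $H_{a,n}$. (v) The subgroup $\mathbb{S}_\delta=\{\mathrm{Id}_{B_{d,P}}\}$. (vi) The isotropy subgroup $\mathbb{G}\cong\mathbb{U}\rtimes(\mathbb{H}\times\mathbb{S})_\delta$.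
   Context: $k$ is a field of characteristic zero. For a $k$-algebra $B$, $\mathrm{Aut}(B)$ is the group of $k$-algebra automorphisms of $B$, and a locally nilpotent derivation is a $k$-derivation $\delta$ of $B$ such that every $b\in B$ is killed by some power of $\delta$. The isotropy subgroup of $\delta$ is $\mathrm{Aut}(\delta)=\{\sigma\in\mathrm{Aut}(B):\sigma\delta=\delta\sigma\}$. For a subgroup $G\subseteq\mathrm{Aut}(B)$, $G_\delta:=G\cap\mathrm{Aut}(\delta)$. Generalised Danielewski surface in standard form: $d\geqslant 2$, $r\geqslant 2$, $P(X,Y_1)=\prod_{i=1}^{r}(Y_1-\sigma_i(X))$ with $\sigma_i(X)\in k[X]$, and $B_{d,P}=k[X,Y_1,Y_2]/(X^dY_2-P(X,Y_1))$; $x,y_1,y_2$ are the images of $X,Y_1,Y_2$. The canonical locally nilpotent derivation is $D_{d,P}=x^d\frac{\partial}{\partial y_1}+\frac{\partial P}{\partial y_1}\frac{\partial}{\partial y_2}$, i.e. $D_{d,P}(x)=0$, $D_{d,P}(y_1)=x^d$, $D_{d,P}(y_2)=\frac{\partial P}{\partial Y_1}(x,y_1)$. Let $\mathcal{S}_r$ be the symmetric group on $r$ letters with identity $\mathrm{id}$. The following description of the automorphisms, attributed to Dubouloz and Poloni, is taken as known. Every automorphism of $B_{d,P}$ is uniquely determined by a datum $(\alpha,\mu,a,b(x))\in\mathcal{S}_r\times k^*\times k^*\times k[x]$ such that the polynomial $c(x):=\sigma_{\alpha(i)}(ax)-\mu\sigma_i(x)$ does not depend on $i\in\{1,\dots,r\}$;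 it is induced by $$X\mapsto aX,\quad Y_1\mapsto \mu Y_1+\tilde c(X),\quad Y_2\mapsto a^{-d}\mu^rY_2+(aX)^{-d}\Big(\prod_{i=1}^{r}(\mu Y_1+\tilde c(X)-\sigma_i(aX))-\mu^r\prod_{i=1}^{r}(Y_1-\sigma_i(X))\Big),$$ where $\tilde c(X)=c(X)+X^db(X)$. Moreover: - For each $b(x)\in k[x]$, the datum $(\mathrm{id},1,1,b(x))$ induces the automorphism $x\mapsto x$, $y_1\mapsto y_1+x^db(x)$, $y_2\mapsto y_2+x^{-d}(P(x,y_1+x^db(x))-P(x,y_1))$. - If $a^q\neq1$ for every $q\in\{1,\dots,d-1\}$, then there exist $\tau(x)\in k[x]$, $Q(y_1)\in k[y_1]$ such that $P(x,y_1+\tau(x))=Q(y_1)$, and the datum $(\mathrm{id},1,a,0)$ induces the automorphism $H_a$: $x\mapsto ax$, $y_1\mapsto y_1+\tau(ax)-\tau(x)$, $y_2\mapsto a^{-d}y_2$. - If $a^{q_0}=1$ for some minimal $q_0\in\{2,\dots,d-1\}$, then there exist $\tau(x)\in k[x]$, $Q(x,y_1)\in k[x,y_1]$ such that $P(x,y_1+\tau(x))=Q(x^{q_0},y_1)$, and the datum $(\mathrm{id},1,a,0)$ induces the automorphism $H_{a,q_0}$: $x\mapsto ax$, $y_1\mapsto y_1+\tau(ax)-\tau(x)$, $y_2\mapsto a^{-d}y_2$. - If $\alpha=\mathrm{id}$, then $\mu=1$. If $\alpha\neq\mathrm{id}$, then there is an integer $s\geqslant2$ with $\mu^s=1$ and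 $\mu^{s'}\neq1$ for $1\leqslant s'\leqslant s-1$; moreover there exist $\tau(x)\in k[x]$, $Q(x,y_1)\in k[x,y_1]$ such that $P(x,y_1+\tau(x))=y_1^iQ(x,y_1^s)$ (where $i=0,1$), and the datum $(\alpha,\mu,1,0)$ induces the automorphism $x\mapsto x$, $y_1\mapsto\mu y_1+(1-\mu)\tau(x)$, $y_2\mapsto\mu^iy_2$. $\mathbb{U},\mathbb{H},\mathbb{S}$ are the subgroups of $\mathrm{Aut}(B_{d,P})$ consisting of the automorphisms corresponding to data of the type $(\mathrm{id},1,1,b(x))$, $(\mathrm{id},1,a,0)$ and $(\alpha,\mu,1,0)$, respectively. The elements of $\mathbb{H}$ and $\mathbb{S}$ commute and $\mathbb{H}\cap\mathbb{S}$ is trivial; $\mathbb{H}\times\mathbb{S}$ denotes the subgroup $\mathbb{H}\mathbb{S}$ of $\mathrm{Aut}(B_{d,P})$.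
   Formalization: (iv) assumes (id,1,a,0) is a datum, i.e. H_a exists, for every a with a^n=1; else false: d=3, P=Y(Y-1-X), f=1 has n=3 but trivial H. (ii),(iii) likewise presuppose H_a exists; the minimal q_0 is the order of a. (vi) assumes the Dubouloz–Poloni description. *)

theory Defs
  imports
    "HOL-Algebra.Algebra"
    "HOL-Algebra.Algebraic_Closure_Type"
    "HOL-Combinatorics.Permutations"
begin

text \<open>
  Throughout, \<open>k\<close> is a type \<open>'k\<close> of class \<open>field_char_0\<close>.  The rings \<open>k[X]\<close>, \<open>k[X,Y\<^sub>1]\<close> and
  \<open>k[X,Y\<^sub>1,Y\<^sub>2]\<close> are the iterated polynomial rings \<open>'k poly\<close>, \<open>'k poly poly\<close> and
  \<open>'k poly poly poly\<close>; the outermost variable is the last one.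
\<close>

type_synonym 'k poly3 = "'k poly poly poly"

abbreviation X3 :: "'k::field_char_0 poly3" where "X3 \<equiv> [:[:[:0, 1:]:]:]"
abbreviation Y13 :: "'k::field_char_0 poly3" where "Y13 \<equiv> [:[:0, 1:]:]"
abbreviation Y23 :: "'k::field_char_0 poly3" where "Y23 \<equiv> [:0, 1:]"
abbreviation const3 :: "'k::field_char_0 \<Rightarrow> 'k poly3" where "const3 c \<equiv> [:[:[:c:]:]:]"
abbreviation inX3 :: "'k::field_char_0 poly \<Rightarrow> 'k poly3" where "inX3 p \<equiv> [:[:p:]:]"


subsection \<open>The surface and its coordinate ring\<close>

definition dan_P :: "nat \<Rightarrow> (nat \<Rightarrow> 'k::field_char_0 poly) \<Rightarrow> 'k poly poly" where
  "dan_P r \<sigma> = (\<Prod>i=1..r. [:- \<sigma> i, 1:])"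

definition dan_ideal :: "nat \<Rightarrow> 'k::field_char_0 poly poly \<Rightarrow> 'k poly3 set" where
  "dan_ideal d P = PIdl\<^bsub>ring_of_type_algebra\<^esub> (X3 ^ d * Y23 - [:P:])"

definition dan_ring :: "nat \<Rightarrow> 'k::field_char_0 poly poly \<Rightarrow> 'k poly3 set ring" where
  "dan_ring d P = ring_of_type_algebra Quot dan_ideal d P"

definition dan_cls :: "nat \<Rightarrow> 'k::field_char_0 poly poly \<Rightarrow> 'k poly3 \<Rightarrow> 'k poly3 set" where
  "dan_cls d P p = dan_ideal d P +>\<^bsub>ring_of_type_algebra\<^esub> p"

text \<open>
  The map on the quotient induced by a map on \<open>k[X,Y\<^sub>1,Y\<^sub>2]\<close> that is compatible with residue
  classes.
\<close>

definition dan_descend ::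
  "nat \<Rightarrow> 'k::field_char_0 poly poly \<Rightarrow> ('k poly3 \<Rightarrow> 'k poly3) \<Rightarrow> 'k poly3 set \<Rightarrow> 'k poly3 set" where
  "dan_descend d P \<phi> = (\<lambda>b \<in> carrier (dan_ring d P). the_elem ((\<lambda>p. dan_cls d P (\<phi> p)) ` b))"


subsection \<open>Automorphisms, the canonical derivation and isotropy\<close>

definition dan_Aut :: "nat \<Rightarrow> 'k::field_char_0 poly poly \<Rightarrow> ('k poly3 set \<Rightarrow> 'k poly3 set) monoid" where
  "dan_Aut d P = BijGroup (carrier (dan_ring d P))
     \<lparr>carrier := {\<phi> \<in> ring_iso (dan_ring d P) (dan_ring d P).
        \<phi> \<in> extensional (carrier (dan_ring d P)) \<and>
        (\<forall>c. \<phi> (dan_cls d P (const3 c)) = dan_cls d P (const3 c))}\<rparr>"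

text \<open>
  \<open>X\<^sup>d \<partial>/\<partial>Y\<^sub>1 + (\<partial>P/\<partial>Y\<^sub>1) \<partial>/\<partial>Y\<^sub>2\<close> annihilates \<open>X\<^sup>d Y\<^sub>2 - P\<close>, so it descends to the quotient.
\<close>

definition dan_D :: "nat \<Rightarrow> 'k::field_char_0 poly poly \<Rightarrow> 'k poly3 set \<Rightarrow> 'k poly3 set" where
  "dan_D d P = dan_descend d P
     (\<lambda>p. X3 ^ d * map_poly pderiv p + [:pderiv P:] * pderiv p)"

definition dan_delta ::
  "nat \<Rightarrow> 'k::field_char_0 poly poly \<Rightarrow> 'k poly \<Rightarrow> 'k poly3 set \<Rightarrow> 'k poly3 set" where
  "dan_delta d P f =
     (\<lambda>b \<in> carrier (dan_ring d P). dan_cls d P (inX3 f) \<otimes>\<^bsub>dan_ring d P\<^esub> dan_D d P b)"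

definition dan_isotropy ::
  "nat \<Rightarrow> 'k::field_char_0 poly poly \<Rightarrow> ('k poly3 set \<Rightarrow> 'k poly3 set) \<Rightarrow>
   ('k poly3 set \<Rightarrow> 'k poly3 set) set" where
  "dan_isotropy d P \<delta> =
     {\<phi> \<in> carrier (dan_Aut d P). \<forall>b \<in> carrier (dan_ring d P). \<phi> (\<delta> b) = \<delta> (\<phi> b)}"


subsection \<open>Data and the automorphisms they induce\<close>

definition dan_subst ::
  "'k::field_char_0 poly3 \<Rightarrow> 'k poly3 \<Rightarrow> 'k poly3 \<Rightarrow> 'k poly3 \<Rightarrow> 'k poly3" where
  "dan_subst u v w p =
     poly (map_poly (\<lambda>q. poly (map_poly (\<lambda>s. poly (map_poly const3 s) u) q) v) p) w"

definition dan_c ::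
  "(nat \<Rightarrow> 'k::field_char_0 poly) \<Rightarrow> (nat \<Rightarrow> nat) \<Rightarrow> 'k \<Rightarrow> 'k \<Rightarrow> nat \<Rightarrow> 'k poly" where
  "dan_c \<sigma> \<alpha> \<mu> a i = pcompose (\<sigma> (\<alpha> i)) [:0, a:] - smult \<mu> (\<sigma> i)"

definition dan_data ::
  "nat \<Rightarrow> (nat \<Rightarrow> 'k::field_char_0 poly) \<Rightarrow> ((nat \<Rightarrow> nat) \<times> 'k \<times> 'k \<times> 'k poly) set" where
  "dan_data r \<sigma> = {(\<alpha>, \<mu>, a, b). \<alpha> permutes {1..r} \<and> \<mu> \<noteq> 0 \<and> a \<noteq> 0 \<and>
     (\<forall>i\<in>{1..r}. \<forall>j\<in>{1..r}. dan_c \<sigma> \<alpha> \<mu> a i = dan_c \<sigma> \<alpha> \<mu> a j)}"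

text \<open>
  The polynomial \<open>c\<close> is read off at the index 1, which is immaterial for elements of
  \<open>dan_data\<close>.
\<close>

definition dan_ctilde ::
  "nat \<Rightarrow> (nat \<Rightarrow> 'k::field_char_0 poly) \<Rightarrow> (nat \<Rightarrow> nat) \<times> 'k \<times> 'k \<times> 'k poly \<Rightarrow> 'k poly" where
  "dan_ctilde d \<sigma> = (\<lambda>(\<alpha>, \<mu>, a, b). dan_c \<sigma> \<alpha> \<mu> a 1 + [:0, 1:] ^ d * b)"

text \<open>
  For elements of \<open>dan_data\<close> the division by \<open>(aX)\<^sup>d\<close> in \<open>k[X,Y\<^sub>1]\<close> is exact: with \<open>i\<close>
  replaced by \<open>\<alpha>(i)\<close>, the \<open>i\<close>-th factor of the first product is \<open>\<mu>(Y\<^sub>1 - \<sigma>\<^sub>i(X)) + X\<^sup>d b(X)\<close>.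
\<close>

definition dan_aut ::
  "nat \<Rightarrow> nat \<Rightarrow> (nat \<Rightarrow> 'k::field_char_0 poly) \<Rightarrow> (nat \<Rightarrow> nat) \<times> 'k \<times> 'k \<times> 'k poly \<Rightarrow>
   'k poly3 set \<Rightarrow> 'k poly3 set" where
  "dan_aut d r \<sigma> = (\<lambda>(\<alpha>, \<mu>, a, b).
     let ct = dan_ctilde d \<sigma> (\<alpha>, \<mu>, a, b);
         Q = ((\<Prod>i=1..r. [:ct - pcompose (\<sigma> i) [:0, a:], [:\<mu>:]:])
                - [:[:\<mu> ^ r:]:] * (\<Prod>i=1..r. [:- \<sigma> i, 1:])) div [:[:0, a:] ^ d:]
     in dan_descend d (dan_P r \<sigma>)
          (dan_subst (const3 a * X3) (const3 \<mu> * Y13 + inX3 ct)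
            (const3 (inverse a ^ d * \<mu> ^ r) * Y23 + [:Q:])))"

definition dan_U ::
  "nat \<Rightarrow> nat \<Rightarrow> (nat \<Rightarrow> 'k::field_char_0 poly) \<Rightarrow> ('k poly3 set \<Rightarrow> 'k poly3 set) set" where
  "dan_U d r \<sigma> = {dan_aut d r \<sigma> (id, 1, 1, b) | b. (id, 1, 1, b) \<in> dan_data r \<sigma>}"

definition dan_H ::
  "nat \<Rightarrow> nat \<Rightarrow> (nat \<Rightarrow> 'k::field_char_0 poly) \<Rightarrow> ('k poly3 set \<Rightarrow> 'k poly3 set) set" where
  "dan_H d r \<sigma> = {dan_aut d r \<sigma> (id, 1, a, 0) | a. (id, 1, a, 0) \<in> dan_data r \<sigma>}"

definition dan_S ::
  "nat \<Rightarrow> nat \<Rightarrow> (nat \<Rightarrow> 'k::field_char_0 poly) \<Rightarrow> ('k poly3 set \<Rightarrow> 'k poly3 set) set" where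
  "dan_S d r \<sigma> = {dan_aut d r \<sigma> (\<alpha>, \<mu>, 1, 0) | \<alpha> \<mu>. (\<alpha>, \<mu>, 1, 0) \<in> dan_data r \<sigma>}"

text \<open>
  The automorphism \<open>H\<^sub>a\<close>, which is also \<open>H\<^bsub>a,q\<^esub>\<close> when \<open>a\<close> has finite order \<open>q \<in> {2..d-1}\<close>:
  the two notations denote the automorphism induced by the same datum, for different ranges of \<open>a\<close>.
\<close>

definition dan_Ha ::
  "nat \<Rightarrow> nat \<Rightarrow> (nat \<Rightarrow> 'k::field_char_0 poly) \<Rightarrow> 'k \<Rightarrow> 'k poly3 set \<Rightarrow> 'k poly3 set" where
  "dan_Ha d r \<sigma> a = dan_aut d r \<sigma> (id, 1, a, 0)"

definition primitive_root_of_unity :: "nat \<Rightarrow> 'k::field_char_0 \<Rightarrow> bool" where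
  "primitive_root_of_unity n a \<longleftrightarrow> n \<ge> 1 \<and> a ^ n = 1 \<and> (\<forall>q\<in>{1..<n}. a ^ q \<noteq> 1)"


subsection \<open>The description of the automorphisms by Dubouloz and Poloni\<close>

text \<open>
  Here \<open>(\<alpha>, \<mu>, a, b)\<close> ranges over the data of automorphisms of the given surface.  In
  particular the last three clauses assert that, along with \<open>(\<alpha>, \<mu>, a, b)\<close>, also
  \<open>(id, 1, a, 0)\<close> and \<open>(\<alpha>, \<mu>, 1, 0)\<close> are data; this is not automatic from the definition of
  \<open>dan_data\<close>.
\<close>

definition dubouloz_poloni :: "nat \<Rightarrow> nat \<Rightarrow> (nat \<Rightarrow> 'k::field_char_0 poly) \<Rightarrow> bool" where
  "dubouloz_poloni d r \<sigma> \<longleftrightarrow>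
     bij_betw (dan_aut d r \<sigma>) (dan_data r \<sigma>) (carrier (dan_Aut d (dan_P r \<sigma>))) \<and>
     (\<forall>(\<alpha>, \<mu>, a, b) \<in> dan_data r \<sigma>.
       ((\<forall>q\<in>{1..d-1}. a ^ q \<noteq> 1) \<longrightarrow>
         (\<exists>(\<tau> :: 'k poly) (Q :: 'k poly).
            pcompose (dan_P r \<sigma>) [:\<tau>, 1:] = map_poly (\<lambda>c. [:c:]) Q \<and>
            (id, 1, a, 0) \<in> dan_data r \<sigma> \<and>
            dan_aut d r \<sigma> (id, 1, a, 0) = dan_descend d (dan_P r \<sigma>)
              (dan_subst (const3 a * X3) (Y13 + inX3 (pcompose \<tau> [:0, a:] - \<tau>))
                (const3 (inverse a ^ d) * Y23)))) \<and>
       (\<forall>q\<^sub>0\<in>{2..d-1}. primitive_root_of_unity q\<^sub>0 a \<longrightarrow>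
         (\<exists>(\<tau> :: 'k poly) (Q :: 'k poly poly).
            pcompose (dan_P r \<sigma>) [:\<tau>, 1:] =
              map_poly (\<lambda>c. pcompose c (Polynomial.monom 1 q\<^sub>0)) Q \<and>
            (id, 1, a, 0) \<in> dan_data r \<sigma> \<and>
            dan_aut d r \<sigma> (id, 1, a, 0) = dan_descend d (dan_P r \<sigma>)
              (dan_subst (const3 a * X3) (Y13 + inX3 (pcompose \<tau> [:0, a:] - \<tau>))
                (const3 (inverse a ^ d) * Y23)))) \<and>
       (\<alpha> = id \<longrightarrow> \<mu> = 1) \<and>
       (\<alpha> \<noteq> id \<longrightarrow>
         (\<exists>s\<ge>2. primitive_root_of_unity s \<mu> \<and>
           (\<exists>(\<tau> :: 'k poly) (Q :: 'k poly poly). \<exists>i\<in>{0, 1}.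
              pcompose (dan_P r \<sigma>) [:\<tau>, 1:] =
                Polynomial.monom 1 i * pcompose Q (Polynomial.monom 1 s) \<and>
              (\<alpha>, \<mu>, 1, 0) \<in> dan_data r \<sigma> \<and>
              dan_aut d r \<sigma> (\<alpha>, \<mu>, 1, 0) = dan_descend d (dan_P r \<sigma>)
                (dan_subst X3 (const3 \<mu> * Y13 + inX3 (smult (1 - \<mu>) \<tau>))
                  (const3 (\<mu> ^ i) * Y23))))))"


subsection \<open>Semidirect products\<close>

text \<open>
  For subgroups \<open>N\<close>, \<open>K\<close> of \<open>G\<close> such that \<open>K\<close> normalises \<open>N\<close>: the external semidirect product
  of \<open>N\<close> and \<open>K\<close>, with \<open>K\<close> acting on \<open>N\<close> by conjugation in \<open>G\<close>.
\<close>

definition conj_semidirect :: "('a, 'm) monoid_scheme \<Rightarrow> 'a set \<Rightarrow> 'a set \<Rightarrow> ('a \<times> 'a) monoid" where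
  "conj_semidirect G N K =
     \<lparr>carrier = N \<times> K,
      monoid.mult = (\<lambda>(n, h) (n', h'). (n \<otimes>\<^bsub>G\<^esub> (h \<otimes>\<^bsub>G\<^esub> n' \<otimes>\<^bsub>G\<^esub> inv\<^bsub>G\<^esub> h), h \<otimes>\<^bsub>G\<^esub> h')),
      one = (\<one>\<^bsub>G\<^esub>, \<one>\<^bsub>G\<^esub>)\<rparr>"

end

theory Submission
  imports Defs
begin

text \<open>
  Since \<open>x\<close> is not a zero divisor and \<open>x\<^sup>d y\<^sub>2 = P(x, y\<^sub>1)\<close>, an automorphism is determined by the images
  \<open>x \<mapsto> a x\<close> and \<open>y\<^sub>1 \<mapsto> \<mu> y\<^sub>1 + e(x)\<close>, and these compose like affine maps.  Comparing \<open>\<delta>\<close>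
  before and after such an automorphism on \<open>y\<^sub>1\<close> shows that it commutes with \<open>\<delta> = f D\<close> iff
  \<open>a\<^sup>d f(a x) = \<mu> f(x)\<close>, a condition that does not involve \<open>e\<close>.  For \<open>\<mu> = 1\<close> it says that \<open>a\<close> is
  annihilated by all the exponents \<open>d + n\<^sub>i\<close>, i.e. \<open>a\<^sup>n = 1\<close>; for \<open>a = 1\<close> it forces \<open>\<mu> = 1\<close>.
\<close>

section \<open>Iterated polynomial rings\<close>

text \<open>The image of y_2 is given by an exact division and is awkward to compute with. So claims
  about y_2 are multiplied by x^d (or its image (ax)^d), where the relation turns them into claims
  about P(x,y_1), and that power is cancelled afterwards. Equality of endomorphisms and commutation
  with \<delta> are both settled in this way.

  A second obstacle: the permutation \<alpha> cannot be read off the automorphism when some roots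
  coincide, and the splitting of the translation e into c and x^d b is not visible in it either.
  Hence the group law is computed on data, equality of automorphisms is tested on (\<mu>, a, e), and
  averaging over the roots links the two when \<mu> = a = 1.

  The classification enters (vi) twice: every automorphism comes from a datum, and a datum
  (\<alpha>, \<mu>, a, 0) splits into (id, 1, a, 0) and (\<alpha>, \<mu>, 1, 0). The factor
  (\<alpha>, \<mu>, a, 0) itself is isotropic because the criterion ignores translations.\<close>

lemma poly_const_power: "[:a:] ^ n = [:a ^ n:]" for a :: "'a::comm_semiring_1"
  by (induction n) (simp_all add: one_pCons mult.commute)

lemma poly_induct_algebra [case_names const var add mult]:
  fixes Q :: "'a::comm_semiring_1 poly \<Rightarrow> bool"
  assumes "\<And>c. Q [:c:]" and "Q [:0, 1:]"
    and "\<And>p q. Q p \<Longrightarrow> Q q \<Longrightarrow> Q (p + q)" and "\<And>p q. Q p \<Longrightarrow> Q q \<Longrightarrow> Q (p * q)"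
  shows "Q p"
proof (induction p)
  case 0
  then show ?case using assms(1)[of 0] by simp
next
  case (pCons a p)
  have "pCons a p = [:a:] + [:0, 1:] * p" by simp
  then show ?case using pCons assms by metis
qed

text \<open>Elements free of Y_2 get their own induction rule, because maps on classes are first
  controlled on x and y_1; the value at y_2 is then deduced from that at P.\<close>

lemma poly2_induct [case_names const X Y1 add mult]:
  fixes Q :: "'k::field_char_0 poly3 \<Rightarrow> bool"
  assumes "\<And>c. Q (const3 c)" and "Q X3" and "Q Y13"
    and "\<And>p q. Q p \<Longrightarrow> Q q \<Longrightarrow> Q (p + q)" and "\<And>p q. Q p \<Longrightarrow> Q q \<Longrightarrow> Q (p * q)"
  shows "Q [:p:]"
proof (induction p rule: poly_induct_algebra)
  case (const c)
  show ?case
  proof (induction c rule: poly_induct_algebra)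
    case (add p q)
    then show ?case using assms(4)[OF add] by simp
  next
    case (mult p q)
    then show ?case using assms(5)[OF mult] by simp
  qed (use assms in simp_all)
next
  case (add p q)
  then show ?case using assms(4)[OF add] by simp
next
  case (mult p q)
  then show ?case using assms(5)[OF mult] by (simp add: mult.commute)
qed (use assms in simp_all)

lemma poly3_induct [case_names const X Y1 Y2 add mult]:
  fixes Q :: "'k::field_char_0 poly3 \<Rightarrow> bool"
  assumes "\<And>c. Q (const3 c)" and "Q X3" and "Q Y13" and "Q Y23"
    and "\<And>p q. Q p \<Longrightarrow> Q q \<Longrightarrow> Q (p + q)" and "\<And>p q. Q p \<Longrightarrow> Q q \<Longrightarrow> Q (p * q)"
  shows "Q p"
proof (induction p rule: poly_induct_algebra)
  case (const c)
  show ?case by (rule poly2_induct) (use assms in auto)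
qed (use assms in auto)

text \<open>Evaluation after \<open>map_poly h\<close> extends a map of coefficients by a choice of
  image for the variable. \<open>dan_subst\<close> nests three such extensions, so additivity and
  multiplicativity climb one variable at a time.\<close>

lemma poly_map_poly_add:
  fixes h :: "'a::comm_semiring_0 \<Rightarrow> 'b::comm_semiring_0"
  assumes "h 0 = 0" "\<And>a b. h (a + b) = h a + h b"
  shows "poly (map_poly h (p + q)) x = poly (map_poly h p) x + poly (map_poly h q) x"
proof (induction p arbitrary: q)
  case (pCons a p)
  then show ?case using assms
    by (cases q) (simp add: map_poly_pCons algebra_simps)
qed simp

lemma poly_map_poly_mult:
  fixes h :: "'a::comm_semiring_0 \<Rightarrow> 'b::comm_semiring_0"
  assumes h0: "h 0 = 0" and h: "\<And>a b. h (a + b) = h a + h b" "\<And>a b. h (a * b) = h a * h b"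
  shows "poly (map_poly h (p * q)) x = poly (map_poly h p) x * poly (map_poly h q) x"
proof (induction p)
  case (pCons a p)
  have sm: "poly (map_poly h (smult a q)) x = h a * poly (map_poly h q) x"
    by (induction q) (simp_all add: map_poly_pCons h0 h algebra_simps)
  show ?case
    by (simp add: map_poly_pCons h0 poly_map_poly_add[OF h0 h(1)] sm pCons algebra_simps)
qed simp

lemma dan_subst_add: "dan_subst u v w (p + q) = dan_subst u v w p + dan_subst u v w q"
  unfolding dan_subst_def
  by (intro poly_map_poly_add) (simp_all add: poly_map_poly_add)

lemma dan_subst_mult: "dan_subst u v w (p * q) = dan_subst u v w p * dan_subst u v w q"
  unfolding dan_subst_def
  by (intro poly_map_poly_mult) (simp_all add: poly_map_poly_add poly_map_poly_mult)

lemma dan_subst_const: "dan_subst u v w (const3 c) = const3 c"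
  by (simp add: dan_subst_def map_poly_pCons)

lemma dan_subst_X: "dan_subst u v w X3 = u"
  by (simp add: dan_subst_def map_poly_pCons one_pCons[symmetric])

lemma dan_subst_Y1: "dan_subst u v w Y13 = v"
  by (simp add: dan_subst_def map_poly_pCons one_pCons[symmetric])

lemma dan_subst_Y2: "dan_subst u v w Y23 = w"
  by (simp add: dan_subst_def map_poly_pCons one_pCons[symmetric])

lemma dan_subst_diff: "dan_subst u v w (p - q) = dan_subst u v w p - dan_subst u v w q"
  using dan_subst_add[of u v w "p - q" q] by (simp add: algebra_simps)

lemma dan_subst_power: "dan_subst u v w (p ^ n) = dan_subst u v w p ^ n"
  using dan_subst_const[of u v w 1] by (induction n) (simp_all add: dan_subst_mult one_pCons)

lemma dan_subst_prod: "dan_subst u v w (prod g I) = (\<Prod>i\<in>I. dan_subst u v w (g i))"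
  using dan_subst_const[of u v w 1]
  by (induction I rule: infinite_finite_induct) (simp_all add: dan_subst_mult one_pCons)

lemma dan_subst_inX: "dan_subst (const3 a * X3) v w (inX3 s) = inX3 (pcompose s [:0, a:])"
proof (induction s)
  case 0
  then show ?case using dan_subst_const[of _ _ _ 0] by simp
next
  case (pCons c s)
  have "inX3 (pCons c s) = const3 c + X3 * inX3 s" by simp
  then show ?case
    by (simp only: dan_subst_add dan_subst_mult dan_subst_const dan_subst_X pCons)
      (simp add: pcompose_pCons)
qed

lemma prod_const_poly: "(\<Prod>i\<in>I. [:g i:]) = [:prod g I:]" for g :: "'i \<Rightarrow> 'a::comm_semiring_1"
  by (induction I rule: infinite_finite_induct) (simp_all add: one_pCons mult.commute)

text \<open>Factors congruent modulo \<open>c\<close> have congruent products. With \<open>c\<close>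
  equal to X^d this compares the product of the transformed factors with \<mu>^r P and makes the
  division in \<open>dan_aut\<close> exact.\<close>

lemma prod_cong_dvd:
  fixes f g :: "'i \<Rightarrow> 'a::comm_ring_1"
  assumes "\<And>i. i \<in> I \<Longrightarrow> c dvd f i - g i"
  shows "c dvd prod f I - prod g I"
  using assms
proof (induction I rule: infinite_finite_induct)
  case (insert i I)
  have "prod f (insert i I) - prod g (insert i I) =
      f i * (prod f I - prod g I) + (f i - g i) * prod g I"
    unfolding prod.insert[OF insert.hyps] left_diff_distrib right_diff_distrib by simp
  moreover have "c dvd f i - g i" "c dvd prod f I - prod g I" using insert by blast+
  ultimately show ?case by (metis dvd_add dvd_mult dvd_mult2)
qed simp_all

lemma map_poly_pderiv_add: "map_poly pderiv (p + q) = map_poly pderiv p + map_poly pderiv q"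
  by (rule poly_eqI) (simp add: coeff_map_poly pderiv_add)

text \<open>On k[X,Y_1,Y_2] the map \<open>map_poly pderiv\<close> is the partial derivative in Y_1,
  while \<open>pderiv\<close> is the one in Y_2; this is the Leibniz rule for the former.\<close>

lemma map_poly_pderiv_mult:
  fixes p q :: "'a::idom poly poly"
  shows "map_poly pderiv (p * q) = map_poly pderiv p * q + p * map_poly pderiv q"
proof (induction p)
  case (pCons a p)
  have sm: "map_poly pderiv (smult a q) = smult (pderiv a) q + smult a (map_poly pderiv q)"
    by (rule poly_eqI) (simp add: coeff_map_poly pderiv_mult algebra_simps)
  show ?case
    by (simp add: map_poly_pCons map_poly_pderiv_add sm pCons algebra_simps)
qed simp

section \<open>Roots of unity\<close>

text \<open>Bezout over the naturals is one-sided, x u = y v + gcd x y, so no inverse of a is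
  needed; it requires x to be nonzero, whence the case split.\<close>

lemma power_gcd_eq_1:
  fixes a :: "'a::field"
  assumes "a ^ x = 1" "a ^ y = 1" shows "a ^ gcd x y = 1"
proof (cases "x = 0")
  case False
  then obtain u v where "x * u = y * v + gcd x y" using bezout_nat by blast
  then have "a ^ (y * v) * a ^ gcd x y = a ^ (x * u)" by (simp add: power_add)
  then show ?thesis using assms by (simp add: power_mult)
qed (use assms in simp)

lemma power_Gcd_eq_1_iff:
  fixes a :: "'a::field"
  assumes "finite M" shows "a ^ Gcd M = 1 \<longleftrightarrow> (\<forall>m\<in>M. a ^ m = 1)"
proof
  assume 1: "a ^ Gcd M = 1"
  show "\<forall>m\<in>M. a ^ m = 1"
  proof
    fix m assume "m \<in> M"
    then obtain k where "m = Gcd M * k" using Gcd_dvd by blast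
    then show "a ^ m = 1" using 1 by (simp add: power_mult)
  qed
next
  assume "\<forall>m\<in>M. a ^ m = 1"
  with assms show "a ^ Gcd M = 1"
    by (induction M rule: finite_induct) (simp_all add: power_gcd_eq_1)
qed

lemma primitive_root_power_eq_1_iff:
  assumes "primitive_root_of_unity n a" shows "a ^ j = 1 \<longleftrightarrow> n dvd j"
proof -
  have n: "n \<ge> 1" "a ^ n = 1" and q: "\<And>q. q \<in> {1..<n} \<Longrightarrow> a ^ q \<noteq> 1"
    using assms by (auto simp: primitive_root_of_unity_def)
  have "a ^ j = a ^ (n * (j div n) + j mod n)" by simp
  also have "\<dots> = a ^ (j mod n)" unfolding power_add power_mult n(2) by simp
  finally have "a ^ j = 1 \<longleftrightarrow> a ^ (j mod n) = 1" by simp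
  also have "\<dots> \<longleftrightarrow> j mod n = 0"
    using q[of "j mod n"] n(1) by (cases "j mod n = 0") auto
  finally show ?thesis by (simp add: dvd_eq_mod_eq_0)
qed

lemma primitive_rootI:
  assumes "n \<ge> 1" "\<And>j. a ^ j = 1 \<longleftrightarrow> n dvd j" shows "primitive_root_of_unity n a"
  using assms by (auto simp: primitive_root_of_unity_def dest: dvd_imp_le)

text \<open>The step from \<open>m\<close> to \<open>p m\<close>: if \<open>p\<close> divides \<open>m\<close>, a \<open>p\<close>-th root of a primitive \<open>m\<close>-th root of
  unity works; otherwise multiply by a root of \<open>1 + X + \<dots> + X\<^sup>p\<^sup>-\<^sup>1\<close>.\<close>

lemma primitive_root_exists:
  assumes closed: "\<And>p :: 'k::field_char_0 poly. Polynomial.degree p > 0 \<Longrightarrow> \<exists>z. poly p z = 0"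
    and "n \<ge> 1"
  shows "\<exists>a :: 'k. primitive_root_of_unity n a"
  using assms(2)
proof (induction n rule: less_induct)
  case (less n)
  show ?case
  proof (cases "n = 1")
    case True
    then have "primitive_root_of_unity n (1 :: 'k)" by (simp add: primitive_root_of_unity_def)
    then show ?thesis ..
  next
    case False
    then obtain p where p: "Factorial_Ring.prime p" "p dvd n" using prime_factor_nat by blast
    then obtain m where nm: "n = p * m" by (elim dvdE)
    have p0: "p > 1" using p(1) by (rule prime_gt_1_nat)
    have "m \<noteq> 0" using less.prems unfolding nm by (intro notI) simp
    then have m: "m \<ge> 1" "m < n" using p0 unfolding nm by simp_all
    then obtain w :: 'k where w: "primitive_root_of_unity m w" using less.IH by blast
    note w_iff = primitive_root_power_eq_1_iff[OF w]
    show ?thesis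
    proof (cases "p dvd m")
      case True
      have "Polynomial.degree (Polynomial.monom 1 p + [:- w:]) = p"
        using p0 by (simp add: degree_add_eq_left degree_monom_eq)
      then obtain z where "poly (Polynomial.monom 1 p + [:- w:]) z = 0" using closed[of "Polynomial.monom 1 p + [:- w:]"] p0 by auto
      then have z: "z ^ p = w" by (simp add: poly_monom)
      have "z ^ j = 1 \<longleftrightarrow> n dvd j" for j
      proof
        assume j: "z ^ j = 1"
        then have "w ^ j = 1" by (metis z power_mult mult.commute power_one)
        \<comment> \<open>Here p | m is used: m | j already forces p | j, so j = p i and z^j =
          w^i.\<close>
        then have "p dvd j" using w_iff True dvd_trans by blast
        then obtain i where i: "j = p * i" by (elim dvdE)
        then have "w ^ i = 1" using j z by (simp add: power_mult)
        then show "n dvd j" using w_iff i nm by simp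
      next
        assume "n dvd j"
        then obtain i where "j = p * m * i" unfolding nm by (elim dvdE)
        then have "j = p * (m * i)" by (simp only: mult.assoc)
        then show "z ^ j = 1" using z w_iff[of "m * i"] by (simp add: power_mult)
      qed
      then show ?thesis using primitive_rootI less.prems by blast
    next
      case False
      define g :: "'k poly" where "g = (\<Sum>i<p. Polynomial.monom 1 i)"
      have "coeff g (p - 1) \<noteq> 0" using p0 by (simp add: g_def coeff_sum)
      then have "Polynomial.degree g > 0" using p0 le_degree[of g "p - 1"] by linarith
      then obtain z where z: "poly g z = 0" using closed by blast
      have zs: "(\<Sum>i<p. z ^ i) = 0" using z by (simp add: g_def poly_sum poly_monom)
      \<comment> \<open>At z = 1 the sum would be p, which is nonzero in characteristic
        zero.\<close>
      have z1: "z \<noteq> 1" using zs p0 by auto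
      have zp: "z ^ p = 1" using zs power_diff_1_eq[of z p] by simp
      have z_iff: "z ^ j = 1 \<longleftrightarrow> p dvd j" for j
      proof
        assume "z ^ j = 1"
        then have g1: "z ^ gcd p j = 1" by (rule power_gcd_eq_1[OF zp])
        show "p dvd j"
        proof (rule ccontr)
          assume "\<not> p dvd j"
          then have "gcd p j = 1" using p(1) prime_imp_coprime coprime_imp_gcd_eq_1 by blast
          then show False using g1 z1 by simp
        qed
      next
        assume "p dvd j"
        then show "z ^ j = 1" using zp by (auto elim!: dvdE simp: power_mult)
      qed
      have cop: "coprime p m" using False p(1) prime_imp_coprime by blast
      have "(w * z) ^ j = 1 \<longleftrightarrow> n dvd j" for j
      proof
        assume j: "(w * z) ^ j = 1"
        \<comment> \<open>Raising (w z)^j = 1 to the power p removes z, raising it to the power m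
          removes w; coprimality of p and m then gives both divisibilities.\<close>
        have zpj: "z ^ (j * p) = 1" and wmj: "w ^ (j * m) = 1"
          using z_iff[of "j * p"] w_iff[of "j * m"] by simp_all
        have "w ^ (j * p) * z ^ (j * p) = 1" "w ^ (j * m) * z ^ (j * m) = 1"
          using j by (simp_all add: power_mult flip: power_mult_distrib)
        then have "w ^ (j * p) = 1" "z ^ (j * m) = 1" using zpj wmj by simp_all
        then have "m dvd j * p" "p dvd j * m" using w_iff z_iff by blast+
        then have "m dvd j" "p dvd j"
          using cop by (simp_all add: coprime_dvd_mult_left_iff coprime_commute)
        then show "n dvd j" using cop nm divides_mult by blast
      next
        assume "n dvd j"
        then show "(w * z) ^ j = 1"
          using w_iff[of j] z_iff[of j] nm by (metis dvd_mult_left dvd_mult_right mult_1 power_mult_distrib)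
      qed
      then show ?thesis using primitive_rootI less.prems by blast
    qed
  qed
qed

text \<open>The n powers of w are distinct roots of X^n - 1, which has at most n roots, so they
  exhaust them.\<close>

lemma roots_of_unity_powers:
  fixes w :: "'k::field_char_0"
  assumes w: "primitive_root_of_unity n w" and z: "z ^ n = 1"
  obtains j where "j < n" "z = w ^ j"
proof -
  have n: "n \<ge> 1" using w by (simp add: primitive_root_of_unity_def)
  have w0: "w \<noteq> 0" using w n by (auto simp: primitive_root_of_unity_def zero_power)
  let ?p = "Polynomial.monom 1 n + [:- 1:] :: 'k poly"
  have deg: "Polynomial.degree ?p = n" using n by (simp add: degree_add_eq_left degree_monom_eq)
  then have p0: "?p \<noteq> 0" using n by fastforce
  have roots: "{x. poly ?p x = 0} = {x. x ^ n = 1}" by (simp add: poly_monom)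
  have inj: "inj_on (\<lambda>j. w ^ j) {..<n}"
  proof (rule linorder_inj_onI)
    fix i j assume ij: "i < j" "i \<in> {..<n}" "j \<in> {..<n}"
    show "w ^ i \<noteq> w ^ j"
    proof
      assume "w ^ i = w ^ j"
      moreover have "w ^ j = w ^ i * w ^ (j - i)" using ij by (simp flip: power_add)
      ultimately have "w ^ (j - i) = 1" using w0 by simp
      then show False using primitive_root_power_eq_1_iff[OF w] ij by (auto dest: dvd_imp_le)
    qed
  qed auto
  have fin: "finite {x. x ^ n = (1 :: 'k)}" using poly_roots_finite[OF p0] unfolding roots .
  have "(\<lambda>j. w ^ j) ` {..<n} \<subseteq> {x. x ^ n = 1}"
    using primitive_root_power_eq_1_iff[OF w] by (auto simp flip: power_mult)
  moreover have "card {x. x ^ n = (1 :: 'k)} \<le> card ((\<lambda>j. w ^ j) ` {..<n})"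
    using card_poly_roots_bound[OF p0] unfolding roots deg by (simp add: card_image[OF inj])
  ultimately have "(\<lambda>j. w ^ j) ` {..<n} = {x. x ^ n = 1}" using card_seteq[OF fin] by blast
  then have "z \<in> (\<lambda>j. w ^ j) ` {..<n}" using z by simp
  then show ?thesis using that by auto
qed

section \<open>Inner semidirect products\<close>

text \<open>Multiplicativity is the rewriting (u h)(u' h') = u (h u' h^-1) h h'. Injectivity holds
  because u h = u' h' puts u'^-1 u = h' h^-1 into the trivial intersection of N and K.\<close>

lemma conj_semidirect_iso:
  assumes "group A" "subgroup G A" "subgroup N A" "subgroup K A" "N \<subseteq> G" "K \<subseteq> G"
    and int: "N \<inter> K = {\<one>\<^bsub>A\<^esub>}"
    and gen: "\<And>g. g \<in> G \<Longrightarrow> \<exists>n\<in>N. \<exists>k\<in>K. g = n \<otimes>\<^bsub>A\<^esub> k"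
  shows "(\<lambda>(u, h). u \<otimes>\<^bsub>A\<^esub> h) \<in> iso (conj_semidirect A N K) (A\<lparr>carrier := G\<rparr>)"
proof -
  interpret group A by fact
  interpret G: subgroup G A by fact
  interpret N: subgroup N A by fact
  interpret K: subgroup K A by fact
  let ?m = "\<lambda>(u, h). u \<otimes>\<^bsub>A\<^esub> h"
  have hom: "(u \<otimes>\<^bsub>A\<^esub> (h \<otimes>\<^bsub>A\<^esub> u' \<otimes>\<^bsub>A\<^esub> inv\<^bsub>A\<^esub> h)) \<otimes>\<^bsub>A\<^esub> (h \<otimes>\<^bsub>A\<^esub> h') = (u \<otimes>\<^bsub>A\<^esub> h) \<otimes>\<^bsub>A\<^esub> (u' \<otimes>\<^bsub>A\<^esub> h')"
    if "u \<in> N" "u' \<in> N" "h \<in> K" "h' \<in> K" for u u' h h'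
  proof -
    have c: "u \<in> carrier A" "u' \<in> carrier A" "h \<in> carrier A" "h' \<in> carrier A" using that by auto
    have "inv\<^bsub>A\<^esub> h \<otimes>\<^bsub>A\<^esub> (h \<otimes>\<^bsub>A\<^esub> h') = h'" using c by (simp flip: m_assoc)
    then show ?thesis using c by (simp add: m_assoc)
  qed
  have inj: "u = u' \<and> h = h'"
    if "u \<in> N" "u' \<in> N" "h \<in> K" "h' \<in> K" and eq: "u \<otimes>\<^bsub>A\<^esub> h = u' \<otimes>\<^bsub>A\<^esub> h'" for u u' h h'
  proof -
    have c: "u \<in> carrier A" "u' \<in> carrier A" "h \<in> carrier A" "h' \<in> carrier A" using that by auto
    have "inv\<^bsub>A\<^esub> u' \<otimes>\<^bsub>A\<^esub> u = h' \<otimes>\<^bsub>A\<^esub> inv\<^bsub>A\<^esub> h"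
    proof -
      have "inv\<^bsub>A\<^esub> u' \<otimes>\<^bsub>A\<^esub> (u \<otimes>\<^bsub>A\<^esub> h) = h'" unfolding eq using c by (simp flip: m_assoc)
      then show ?thesis using c by (metis inv_closed inv_solve_right m_assoc m_closed)
    qed
    moreover have "inv\<^bsub>A\<^esub> u' \<otimes>\<^bsub>A\<^esub> u \<in> N" "h' \<otimes>\<^bsub>A\<^esub> inv\<^bsub>A\<^esub> h \<in> K" using that by simp_all
    ultimately have "inv\<^bsub>A\<^esub> u' \<otimes>\<^bsub>A\<^esub> u = \<one>\<^bsub>A\<^esub>" using int by auto
    then have "u = u'" using c by (metis inv_comm inv_equality inv_inv inv_closed)
    then show ?thesis using eq c by simp
  qed
  show ?thesis
    unfolding iso_def
  proof (intro CollectI conjI)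
    show "?m \<in> hom (conj_semidirect A N K) (A\<lparr>carrier := G\<rparr>)"
      using assms(5,6) hom by (auto simp: hom_def conj_semidirect_def)
    have "inj_on ?m (N \<times> K)"
      by (rule inj_onI) (clarify, rule inj)
    moreover have "?m ` (N \<times> K) = G"
    proof
      show "?m ` (N \<times> K) \<subseteq> G" using assms(5,6) by auto
      show "G \<subseteq> ?m ` (N \<times> K)"
      proof
        fix g assume "g \<in> G"
        then obtain n k where "n \<in> N" "k \<in> K" "g = n \<otimes>\<^bsub>A\<^esub> k" using gen by blast
        then show "g \<in> ?m ` (N \<times> K)" by (intro image_eqI[of _ _ "(n, k)"]) simp_all
      qed
    qed
    ultimately show "bij_betw ?m (carrier (conj_semidirect A N K)) (carrier (A\<lparr>carrier := G\<rparr>))"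
      by (simp add: bij_betw_def conj_semidirect_def)
  qed
qed

section \<open>The coordinate ring\<close>

lemma monic_dan_P: "lead_coeff (dan_P r \<sigma>) = 1"
  unfolding dan_P_def Polynomial.lead_coeff_prod by simp

lemma pCons_dvd_pConsD:
  fixes c :: "'a::comm_semiring_1"
  assumes "[:c:] dvd p" shows "c dvd coeff p i"
  using assms by (auto elim!: dvdE)

locale danielewski =
  fixes d r :: nat and \<sigma> :: "nat \<Rightarrow> 'k::field_char_0 poly"
  assumes r_pos: "1 \<le> r"
begin

abbreviation "P \<equiv> dan_P r \<sigma>"
abbreviation "cls \<equiv> dan_cls d P"
abbreviation "B \<equiv> dan_ring d P"

definition gen :: "'k poly3" where "gen = X3 ^ d * Y23 - [:P:]"

text \<open>Viewed in Y_2, the generator is linear with leading coefficient X^d and constant term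
  -P. That X does not divide it, and that k[X,Y_1] embeds into the quotient, are both read off this
  form.\<close>

lemma gen_pCons: "gen = [:- P, [:[:0, 1:] ^ d:]:]"
  by (simp add: gen_def poly_const_power)

lemma cls_alt: "cls p = {q. gen dvd q - p}"
proof -
  have "cls p = {x * gen + p | x. True}"
    unfolding dan_cls_def dan_ideal_def gen_def[symmetric]
    by (auto simp: a_r_coset_def' cgenideal_def ring_of_type_algebra_def)
  also have "\<dots> = {q. gen dvd q - p}"
    by (auto simp: dvd_def algebra_simps)
  finally show ?thesis .
qed

text \<open>Equality of cosets becomes divisibility in the polynomial ring, which lets all later
  computations run on representatives.\<close>

lemma cls_eq_iff: "cls p = cls q \<longleftrightarrow> gen dvd p - q"
proof
  assume "cls p = cls q"
  moreover have "p \<in> cls p" unfolding cls_alt by simp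
  ultimately show "gen dvd p - q" unfolding cls_alt by blast
next
  assume pq: "gen dvd p - q"
  have "gen dvd x - p \<longleftrightarrow> gen dvd x - q" for x
    using dvd_add_left_iff[OF pq, of "x - p"] by (simp add: add.commute)
  then show "cls p = cls q" unfolding cls_alt by blast
qed

lemma ideal_dan: "ideal (dan_ideal d P) ring_of_type_algebra"
  unfolding dan_ideal_def
  by (rule cring.cgenideal_ideal[OF cring_from_type_algebra]) (simp add: ring_of_type_algebra_def)

lemma carrier_B: "carrier B = range cls"
  by (auto simp: dan_ring_def FactRing_def A_RCOSETS_def' dan_cls_def ring_of_type_algebra_def)

lemma cls_carrier [simp]: "cls p \<in> carrier B"
  by (simp add: carrier_B)

lemma B_mult: "cls p \<otimes>\<^bsub>B\<^esub> cls q = cls (p * q)"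
  using ideal.rcoset_mult_add[OF ideal_dan, of p q]
  by (simp add: dan_ring_def FactRing_def dan_cls_def ring_of_type_algebra_def)

lemma B_add: "cls p \<oplus>\<^bsub>B\<^esub> cls q = cls (p + q)"
proof -
  interpret abelian_group "ring_of_type_algebra :: 'k poly3 ring"
    using ring_from_type_algebra ring_def by blast
  interpret ideal "dan_ideal d P" ring_of_type_algebra by (rule ideal_dan)
  show ?thesis
    using a_rcos_sum[of p q]
    by (simp add: dan_ring_def FactRing_def dan_cls_def ring_of_type_algebra_def)
qed

lemma B_one: "\<one>\<^bsub>B\<^esub> = cls 1"
  by (simp add: dan_ring_def FactRing_def dan_cls_def ring_of_type_algebra_def)

lemma ring_B: "ring B"
  unfolding dan_ring_def by (rule ideal.quotient_is_ring[OF ideal_dan])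

lemma cls_rel: "cls (X3 ^ d * Y23) = cls [:P:]"
  by (simp add: cls_eq_iff gen_def)

lemma X_prime: "prime_elem (X3 :: 'k poly3)"
proof -
  have "prime_elem [:0, 1::'k:]"
  proof (rule prime_elemI)
    fix a b :: "'k poly" assume "[:0, 1:] dvd a * b"
    then show "[:0, 1:] dvd a \<or> [:0, 1:] dvd b"
      using poly_eq_0_iff_dvd[of "a * b" 0] poly_eq_0_iff_dvd[of a 0] poly_eq_0_iff_dvd[of b 0]
      by auto
  qed (auto simp: is_unit_poly_iff)
  then show ?thesis by (intro lift_prime_elem_poly)
qed

text \<open>As \<open>P\<close> is monic in \<open>Y\<^sub>1\<close>, the prime \<open>X\<close> does not divide \<open>X\<^sup>d Y\<^sub>2 - P\<close>; hence \<open>x\<close> is not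
  a zero divisor, and an algebra map is determined by the images of \<open>x\<close> and \<open>y\<^sub>1\<close>.\<close>

lemma X_not_dvd_gen: "\<not> X3 dvd gen"
proof
  assume "X3 dvd gen"
  then have "[:[:0, 1:]:] dvd - P"
    using pCons_dvd_pConsD[of "[:[:0, 1:]:]" gen 0] by (simp add: gen_pCons)
  then have "[:0, 1:] dvd lead_coeff P"
    using pCons_dvd_pConsD[of "[:0, 1:]" "P" "degree P"] by simp
  then have "[:0, 1:] dvd (1 :: 'k poly)" by (simp only: monic_dan_P)
  then show False by (auto simp: is_unit_poly_iff)
qed

lemma X_cancel: "gen dvd X3 * w \<Longrightarrow> gen dvd w"
proof -
  assume "gen dvd X3 * w"
  then obtain q where q: "X3 * w = gen * q" by (elim dvdE)
  then have "X3 dvd gen * q" using dvd_triv_left[of X3 w] by (simp only:)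
  then have "X3 dvd q" using X_prime X_not_dvd_gen prime_elem_dvd_mult_iff by blast
  then obtain q' where "q = X3 * q'" by (elim dvdE)
  with q have "X3 * w = X3 * (gen * q')" by (simp only: mult.left_commute)
  moreover have "(X3 :: 'k poly3) \<noteq> 0" by simp
  ultimately have "w = gen * q'" using mult_left_cancel[of "X3 :: 'k poly3" w "gen * q'"] by blast
  then show ?thesis by (metis dvd_triv_left)
qed

lemma aX_cancel:
  assumes "a \<noteq> 0" "gen dvd (const3 a * X3) ^ n * w"
  shows "gen dvd w"
  using assms(2)
proof (induction n)
  case (Suc n)
  have "gen dvd X3 * (const3 a * ((const3 a * X3) ^ n * w))"
    using Suc.prems by (simp only: power_Suc mult_ac)
  then have "gen dvd const3 a * ((const3 a * X3) ^ n * w)" by (rule X_cancel)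
  then have "gen dvd const3 (inverse a) * (const3 a * ((const3 a * X3) ^ n * w))"
    by (rule dvd_mult)
  also have "const3 (inverse a) * (const3 a * ((const3 a * X3) ^ n * w)) = (const3 a * X3) ^ n * w"
    using assms(1) by (simp add: one_pCons[symmetric])
  finally show ?case by (rule Suc.IH)
qed simp

lemma cls_aX_cancel:
  assumes "a \<noteq> 0" "cls ((const3 a * X3) ^ n * v) = cls ((const3 a * X3) ^ n * w)"
  shows "cls v = cls w"
proof -
  have "gen dvd (const3 a * X3) ^ n * (v - w)"
    using assms(2) by (simp only: cls_eq_iff right_diff_distrib)
  then show ?thesis using aX_cancel[OF assms(1)] cls_eq_iff by blast
qed

text \<open>A nonzero multiple of \<open>gen\<close> has positive degree in Y_2, so it is never a
  nonzero element of k[X,Y_1]. This is what permits comparing coefficients after passing to the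
  quotient.\<close>

lemma cls_inj: "cls [:p:] = cls [:q:] \<longleftrightarrow> p = q"
proof
  assume "cls [:p:] = cls [:q:]"
  then obtain s where s: "[:p - q:] = gen * s"
    unfolding cls_eq_iff by (auto elim!: dvdE)
  have deg: "degree gen = 1" unfolding gen_pCons by simp
  have "s = 0"
  proof (rule ccontr)
    assume "s \<noteq> 0"
    moreover have "gen \<noteq> 0" using deg by fastforce
    ultimately have "degree (gen * s) = 1 + degree s" using deg by (metis degree_mult_eq)
    then show False by (simp add: s[symmetric])
  qed
  with s show "p = q" by simp
qed simp

text \<open>Compatibility with residue classes makes the image of a coset a singleton, so
  \<open>the_elem\<close> returns the intended class.\<close>

lemma descend_cls:
  assumes "\<And>p q. gen dvd p - q \<Longrightarrow> gen dvd \<phi> p - \<phi> q"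
  shows "dan_descend d P \<phi> (cls p) = cls (\<phi> p)"
proof -
  have "(\<lambda>q. cls (\<phi> q)) ` cls p = {cls (\<phi> p)}"
  proof -
    have "cls (\<phi> q) = cls (\<phi> p)" if "q \<in> cls p" for q
      using that assms unfolding cls_eq_iff by (simp add: cls_alt)
    moreover have "p \<in> cls p" by (simp add: cls_alt)
    ultimately show ?thesis by blast
  qed
  then show ?thesis by (simp add: dan_descend_def)
qed

lemma descend_ext: "dan_descend d P \<phi> \<in> extensional (carrier B)"
  by (simp add: dan_descend_def)

section \<open>Algebra endomorphisms\<close>


text \<open>The conditions of \<open>dan_Aut\<close> except bijectivity: an induced map is first
  known only to be a homomorphism, and its bijectivity is obtained later from the inverse
  datum.\<close>

definition endo :: "('k poly3 set \<Rightarrow> 'k poly3 set) \<Rightarrow> bool" where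
  "endo \<phi> \<longleftrightarrow> \<phi> \<in> ring_hom B B \<and> \<phi> \<in> extensional (carrier B) \<and>
     (\<forall>c. \<phi> (cls (const3 c)) = cls (const3 c))"

text \<open>Only x and y_1 are recorded, since for a \<noteq> 0 the relation determines the image of
  y_2. The translation e is an arbitrary polynomial in x, so that composites have the same
  shape.\<close>

definition acts :: "('k poly3 set \<Rightarrow> 'k poly3 set) \<Rightarrow> 'k \<Rightarrow> 'k \<Rightarrow> 'k poly \<Rightarrow> bool" where
  "acts \<phi> \<mu> a e \<longleftrightarrow> \<phi> (cls X3) = cls (const3 a * X3) \<and>
     \<phi> (cls Y13) = cls (const3 \<mu> * Y13 + inX3 e)"

lemma endo_add:
  "endo \<phi> \<Longrightarrow> \<phi> (cls p) = cls p' \<Longrightarrow> \<phi> (cls q) = cls q' \<Longrightarrow> \<phi> (cls (p + q)) = cls (p' + q')"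
  unfolding endo_def using ring_hom_add[of \<phi> B B "cls p" "cls q"] by (simp add: B_add)

lemma endo_mult:
  "endo \<phi> \<Longrightarrow> \<phi> (cls p) = cls p' \<Longrightarrow> \<phi> (cls q) = cls q' \<Longrightarrow> \<phi> (cls (p * q)) = cls (p' * q')"
  unfolding endo_def using ring_hom_mult[of \<phi> B B "cls p" "cls q"] by (simp add: B_mult)

lemma endo_const: "endo \<phi> \<Longrightarrow> \<phi> (cls (const3 c)) = cls (const3 c)"
  by (simp add: endo_def)

lemma endo_ex:
  assumes "endo \<phi>" obtains p' where "\<phi> (cls p) = cls p'"
proof -
  have "\<phi> (cls p) \<in> carrier B"
    using assms ring_hom_closed[of \<phi> B B "cls p"] by (auto simp: endo_def)
  then show ?thesis using that by (auto simp: carrier_B)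
qed

lemma endo_power:
  assumes "endo \<phi>" "\<phi> (cls p) = cls p'" shows "\<phi> (cls (p ^ n)) = cls (p' ^ n)"
proof (induction n)
  case 0
  show ?case using endo_const[OF assms(1), of 1] by (simp add: one_pCons)
next
  case (Suc n)
  show ?case using endo_mult[OF assms(1) assms(2) Suc] by simp
qed

text \<open>The image \<open>w\<close> of Y_2 is arbitrary, because \<open>[:p:]\<close> does not
  contain Y_2; the substitution can thus be used before anything is known about y_2.\<close>

lemma acts_poly2:
  assumes "endo \<phi>" "acts \<phi> \<mu> a e"
  shows "\<phi> (cls [:p:]) = cls (dan_subst (const3 a * X3) (const3 \<mu> * Y13 + inX3 e) w [:p:])"
proof (induction p rule: poly2_induct)
  case (const c)
  show ?case unfolding dan_subst_const by (rule endo_const[OF assms(1)])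
next
  case X
  show ?case unfolding dan_subst_X using assms(2) by (simp only: acts_def)
next
  case Y1
  show ?case unfolding dan_subst_Y1 using assms(2) by (simp only: acts_def)
next
  case (add p q)
  show ?case unfolding dan_subst_add by (rule endo_add[OF assms(1) add])
next
  case (mult p q)
  show ?case unfolding dan_subst_mult by (rule endo_mult[OF assms(1) mult])
qed

lemma acts_inX:
  assumes "endo \<phi>" "acts \<phi> \<mu> a e"
  shows "\<phi> (cls (inX3 s)) = cls (inX3 (pcompose s [:0, a:]))"
  using acts_poly2[OF assms, of "[:s:]"] by (simp only: dan_subst_inX)

text \<open>The two maps agree on k[x,y_1], hence on P = x^d y_2. Thus (ax)^d times their values at
  y_2 agree, and (ax)^d cancels as a \<noteq> 0.\<close>

lemma endo_eqI:
  assumes "endo \<phi>" "endo \<psi>" "acts \<phi> \<mu> a e" "acts \<psi> \<mu> a e" "a \<noteq> 0"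
  shows "\<phi> = \<psi>"
proof -
  have eq2: "\<phi> (cls [:p:]) = \<psi> (cls [:p:])" for p
    using acts_poly2[OF assms(1,3), of p undefined] acts_poly2[OF assms(2,4), of p undefined] by simp
  obtain v w where v: "\<phi> (cls Y23) = cls v" and w: "\<psi> (cls Y23) = cls w"
    using endo_ex assms(1,2) by metis
  have "\<phi> (cls (X3 ^ d * Y23)) = cls ((const3 a * X3) ^ d * v)"
    using assms(3) unfolding acts_def
    by (intro endo_mult[OF assms(1)] endo_power[OF assms(1)] v) simp
  moreover have "\<psi> (cls (X3 ^ d * Y23)) = cls ((const3 a * X3) ^ d * w)"
    using assms(4) unfolding acts_def
    by (intro endo_mult[OF assms(2)] endo_power[OF assms(2)] w) simp
  ultimately have "cls ((const3 a * X3) ^ d * v) = cls ((const3 a * X3) ^ d * w)"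
    using eq2[of P] by (simp only: cls_rel)
  then have vw: "cls v = cls w" by (rule cls_aX_cancel[OF assms(5)])
  have "\<phi> (cls p) = \<psi> (cls p)" for p
  proof (induction p rule: poly3_induct)
    case Y2
    show ?case using v w vw by simp
  next
    case (add p q)
    obtain p' q' where "\<psi> (cls p) = cls p'" "\<psi> (cls q) = cls q'" using endo_ex assms(2) by metis
    with add show ?case
      using endo_add[OF assms(1), of p p' q q'] endo_add[OF assms(2), of p p' q q'] by simp
  next
    case (mult p q)
    obtain p' q' where "\<psi> (cls p) = cls p'" "\<psi> (cls q) = cls q'" using endo_ex assms(2) by metis
    with mult show ?case
      using endo_mult[OF assms(1), of p p' q q'] endo_mult[OF assms(2), of p p' q q'] by simp
  qed (use eq2 in auto)
  then show ?thesis using assms(1,2)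
    by (intro extensionalityI[of _ "carrier B"]) (auto simp: endo_def carrier_B)
qed

lemma acts_unique:
  assumes "acts \<phi> \<mu> a e" "acts \<phi> \<mu>' a' e'" shows "\<mu> = \<mu>' \<and> a = a' \<and> e = e'"
proof -
  have "cls [:[:[:0, a:]:]:] = cls [:[:[:0, a':]:]:]" "cls [:[:e, [:\<mu>:]:]:] = cls [:[:e', [:\<mu>':]:]:]"
    using assms by (simp_all add: acts_def)
  then show ?thesis unfolding cls_inj by simp
qed

lemma endo_compose:
  assumes "endo \<phi>" "endo \<psi>" shows "endo (compose (carrier B) \<phi> \<psi>)"
proof -
  have c: "\<psi> x \<in> carrier B" if "x \<in> carrier B" for x
    using that assms(2) ring_hom_closed[of \<psi> B B x] by (simp add: endo_def)
  interpret ring B by (rule ring_B)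
  show ?thesis
    unfolding endo_def
  proof (intro conjI allI)
    show "compose (carrier B) \<phi> \<psi> \<in> ring_hom B B"
      using assms c by (auto simp: endo_def ring_hom_def compose_eq)
    show "compose (carrier B) \<phi> \<psi> \<in> extensional (carrier B)" by (simp add: compose_def)
  qed (use assms in \<open>simp add: compose_eq endo_const\<close>)
qed

text \<open>The composite applies \<open>\<psi>\<close> first, and \<open>\<phi>\<close> then acts
  on the result \<nu> y_1 + e'(x): so e is scaled by \<nu>, while e' is evaluated at a x.\<close>

lemma acts_compose:
  assumes "endo \<phi>" "acts \<phi> \<mu> a e" "acts \<psi> \<nu> a' e'"
  shows "acts (compose (carrier B) \<phi> \<psi>) (\<nu> * \<mu>) (a * a') (smult \<nu> e + pcompose e' [:0, a:])"
proof -
  have "\<phi> (cls (const3 a' * X3)) = cls (const3 a' * (const3 a * X3))"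
    using assms(2) by (intro endo_mult[OF assms(1) endo_const[OF assms(1)]]) (simp only: acts_def)
  moreover have "\<phi> (cls (const3 \<nu> * Y13 + inX3 e')) =
      cls (const3 \<nu> * (const3 \<mu> * Y13 + inX3 e) + inX3 (pcompose e' [:0, a:]))"
    using assms(2)
    by (intro endo_add[OF assms(1)] endo_mult[OF assms(1)] endo_const[OF assms(1)]
      acts_inX[OF assms(1,2)]) (simp only: acts_def)
  ultimately show ?thesis using assms(3)
    by (simp add: acts_def compose_eq mult.commute)
qed

definition idB :: "'k poly3 set \<Rightarrow> 'k poly3 set" where "idB = (\<lambda>x\<in>carrier B. x)"

lemma endo_id: "endo idB" and acts_id: "acts idB 1 1 0"
proof -
  interpret ring B by (rule ring_B)
  show "endo idB" by (auto simp: endo_def idB_def ring_hom_def)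
  show "acts idB 1 1 0" by (simp add: acts_def idB_def one_pCons[symmetric])
qed

section \<open>The automorphism group\<close>

abbreviation "A \<equiv> dan_Aut d P"

lemma carrier_A: "\<phi> \<in> carrier A \<longleftrightarrow> endo \<phi> \<and> bij_betw \<phi> (carrier B) (carrier B)"
  by (auto simp: dan_Aut_def endo_def ring_iso_def)

lemma carrier_A_Bij: "carrier A \<subseteq> Bij (carrier B)"
  by (auto simp: carrier_A Bij_def endo_def)

lemma A_mult: "\<phi> \<in> carrier A \<Longrightarrow> \<psi> \<in> carrier A \<Longrightarrow> \<phi> \<otimes>\<^bsub>A\<^esub> \<psi> = compose (carrier B) \<phi> \<psi>"
  using carrier_A_Bij by (auto simp: dan_Aut_def BijGroup_def)

lemma A_one: "\<one>\<^bsub>A\<^esub> = idB"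
  by (simp add: dan_Aut_def BijGroup_def idB_def)

lemma endo_inverse:
  assumes "\<phi> \<in> carrier A"
  shows "restrict (inv_into (carrier B) \<phi>) (carrier B) \<in> carrier A"
proof -
  let ?\<psi> = "restrict (inv_into (carrier B) \<phi>) (carrier B)"
  have \<phi>: "endo \<phi>" and bij: "bij_betw \<phi> (carrier B) (carrier B)"
    using assms by (auto simp: carrier_A)
  interpret ring B by (rule ring_B)
  have iso: "inv_into (carrier B) \<phi> \<in> ring_iso B B"
    using \<phi> bij by (intro ring_iso_set_sym ring_B) (auto simp: endo_def ring_iso_def)
  then have "?\<psi> \<in> ring_hom B B" by (auto simp: ring_iso_def ring_hom_def)
  moreover have "?\<psi> (cls (const3 c)) = cls (const3 c)" for c
    using bij by (simp add: bij_betw_def inv_into_f_eq endo_const[OF \<phi>])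
  moreover have "bij_betw ?\<psi> (carrier B) (carrier B)"
    using bij_betw_inv_into[OF bij] by (simp cong: bij_betw_cong)
  ultimately show ?thesis by (simp add: carrier_A endo_def)
qed

lemma A_subgroup: "subgroup (carrier A) (BijGroup (carrier B))"
proof
  show "carrier A \<subseteq> carrier (BijGroup (carrier B))" using carrier_A_Bij by (simp add: BijGroup_def)
  show "\<one>\<^bsub>BijGroup (carrier B)\<^esub> \<in> carrier A"
    using endo_id by (auto simp: BijGroup_def carrier_A idB_def bij_betw_def inj_on_def)
  show "inv\<^bsub>BijGroup (carrier B)\<^esub> \<phi> \<in> carrier A" if "\<phi> \<in> carrier A" for \<phi>
    using endo_inverse[OF that] carrier_A_Bij that by (subst inv_BijGroup) auto
  show "\<phi> \<otimes>\<^bsub>BijGroup (carrier B)\<^esub> \<psi> \<in> carrier A" if "\<phi> \<in> carrier A" "\<psi> \<in> carrier A" for \<phi> \<psi>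
  proof -
    have "\<phi> \<otimes>\<^bsub>BijGroup (carrier B)\<^esub> \<psi> = compose (carrier B) \<phi> \<psi>"
      using carrier_A_Bij that by (auto simp: BijGroup_def)
    then show ?thesis using that endo_compose bij_betw_compose[of \<psi> "carrier B" "carrier B" \<phi>]
      by (simp add: carrier_A)
  qed
qed

lemma A_eq: "BijGroup (carrier B)\<lparr>carrier := carrier A\<rparr> = A"
  unfolding dan_Aut_def by simp

lemma group_A: "group A"
  using subgroup.subgroup_is_group[OF A_subgroup group_BijGroup] unfolding A_eq .

section \<open>The automorphism induced by a datum\<close>

abbreviation "\<Phi> \<equiv> dan_aut d r \<sigma>"
abbreviation "data \<equiv> dan_data r \<sigma>"

lemma data_iff: "(\<alpha>, \<mu>, a, b) \<in> data \<longleftrightarrow> \<alpha> permutes {1..r} \<and> \<mu> \<noteq> 0 \<and> a \<noteq> 0 \<and>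
    (\<forall>i\<in>{1..r}. \<forall>j\<in>{1..r}. dan_c \<sigma> \<alpha> \<mu> a i = dan_c \<sigma> \<alpha> \<mu> a j)"
  unfolding dan_data_def mem_Collect_eq prod.case ..

lemma dataI:
  assumes "\<alpha> permutes {1..r}" "\<mu> \<noteq> 0" "a \<noteq> 0" "\<And>i. i \<in> {1..r} \<Longrightarrow> dan_c \<sigma> \<alpha> \<mu> a i = c"
  shows "(\<alpha>, \<mu>, a, b) \<in> data"
  unfolding data_iff
  by (intro conjI ballI assms(1-3)) (rule trans[OF assms(4) assms(4)[symmetric]])

lemma data_basic:
  assumes "(\<alpha>, \<mu>, a, b) \<in> data" shows "\<alpha> permutes {1..r}" "\<mu> \<noteq> 0" "a \<noteq> 0"
  using assms unfolding data_iff by - (elim conjE, assumption)+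

lemma dataD:
  assumes "(\<alpha>, \<mu>, a, b) \<in> data" "i \<in> {1..r}"
  shows "dan_c \<sigma> \<alpha> \<mu> a i = dan_c \<sigma> \<alpha> \<mu> a 1"
proof -
  have "1 \<in> {1..r}" using r_pos by simp
  then show ?thesis using assms unfolding data_iff by blast
qed

text \<open>Since the translation equals \<sigma>_{\<alpha>(i)}(aX) - \<mu> \<sigma>_i + X^d b for
  each i, the factor with index \<alpha>(i) is \<mu> (Y_1 - \<sigma>_i) modulo X^d. Reindexing the
  product by \<alpha> then gives \<mu>^r P modulo X^d.\<close>

lemma datum_exact:
  assumes t: "(\<alpha>, \<mu>, a, b) \<in> data"
  defines "ct \<equiv> dan_ctilde d \<sigma> (\<alpha>, \<mu>, a, b)"
  shows "[:[:0, a:] ^ d:] dvd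
    (\<Prod>i=1..r. [:ct - pcompose (\<sigma> i) [:0, a:], [:\<mu>:]:]) - [:[:\<mu> ^ r:]:] * P"
proof -
  let ?g = "\<lambda>i. [:ct - pcompose (\<sigma> i) [:0, a:], [:\<mu>:]:]"
  note \<alpha> = data_basic(1)[OF t] and a = data_basic(3)[OF t] and c = dataD[OF t, symmetric]
  have g: "?g (\<alpha> i) = [:[:\<mu>:]:] * [:- \<sigma> i, 1:] + [:[:0, 1:] ^ d:] * [:b:]" if "i \<in> {1..r}" for i
  proof -
    have "ct = dan_c \<sigma> \<alpha> \<mu> a i + [:0, 1:] ^ d * b"
      unfolding ct_def dan_ctilde_def prod.case c[OF that] ..
    then show ?thesis by (simp add: dan_c_def)
  qed
  have "[:[:0, 1:] ^ d:] dvd (\<Prod>i=1..r. ?g (\<alpha> i)) - (\<Prod>i=1..r. [:[:\<mu>:]:] * [:- \<sigma> i, 1:])"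
    by (rule prod_cong_dvd) (simp only: g add_diff_cancel_left' dvd_triv_left)
  also have "(\<Prod>i=1..r. ?g (\<alpha> i)) = (\<Prod>i=1..r. ?g i)"
    using prod.permute[OF \<alpha>, of ?g] by (simp add: o_def)
  also have "(\<Prod>i=1..r. [:[:\<mu>:]:] * [:- \<sigma> i, 1:]) = [:[:\<mu> ^ r:]:] * P"
    by (simp only: prod.distrib dan_P_def) (simp add: poly_const_power)
  finally have dvd: "[:[:0, 1:] ^ d:] dvd (\<Prod>i=1..r. ?g i) - [:[:\<mu> ^ r:]:] * P" .
  \<comment> \<open>The definition divides by (aX)^d rather than X^d; the two differ by the unit
    a^d.\<close>
  have "[:[:0, 1:] ^ d:] = [:[:0, a:] ^ d:] * [:[:inverse a ^ d:]:]"
  proof -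
    have "[:0, 1:] ^ d = ([:0, a:] * [:inverse a:]) ^ d" using a by simp
    also have "\<dots> = [:0, a:] ^ d * [:inverse a ^ d:]"
      by (simp only: power_mult_distrib poly_const_power)
    finally show ?thesis by simp
  qed
  with dvd have "[:[:0, a:] ^ d:] * [:[:inverse a ^ d:]:] dvd (\<Prod>i=1..r. ?g i) - [:[:\<mu> ^ r:]:] * P"
    by (simp only:)
  then show ?thesis by (rule dvd_mult_left)
qed

text \<open>Multiplying the image of Y_2 by (aX)^d gives \<mu>^r X^d Y_2 + N - \<mu>^r P, where N is
  the image of P. Subtracting N leaves \<mu>^r times the generator.\<close>

lemma subst_gen:
  assumes t: "(\<alpha>, \<mu>, a, b) \<in> data"
  defines "ct \<equiv> dan_ctilde d \<sigma> (\<alpha>, \<mu>, a, b)"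
  defines "Q \<equiv> ((\<Prod>i=1..r. [:ct - pcompose (\<sigma> i) [:0, a:], [:\<mu>:]:])
                - [:[:\<mu> ^ r:]:] * (\<Prod>i=1..r. [:- \<sigma> i, 1:])) div [:[:0, a:] ^ d:]"
  shows "dan_subst (const3 a * X3) (const3 \<mu> * Y13 + inX3 ct)
      (const3 (inverse a ^ d * \<mu> ^ r) * Y23 + [:Q:]) gen = const3 (\<mu> ^ r) * gen"
proof -
  let ?u = "const3 a * X3" and ?v = "const3 \<mu> * Y13 + inX3 ct"
    and ?w = "const3 (inverse a ^ d * \<mu> ^ r) * Y23 + [:Q:]"
  let ?N = "\<Prod>i=1..r. [:ct - pcompose (\<sigma> i) [:0, a:], [:\<mu>:]:]"
  have a: "a \<noteq> 0" using data_basic(3)[OF t] .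
  have Q: "[:[:0, a:] ^ d:] * Q = ?N - [:[:\<mu> ^ r:]:] * P"
    using datum_exact[OF t] unfolding Q_def ct_def[symmetric] dan_P_def[symmetric]
    by (rule dvd_mult_div_cancel)
  have fac: "dan_subst ?u ?v ?w [:[:- \<sigma> i, 1:]:] = [:[:ct - pcompose (\<sigma> i) [:0, a:], [:\<mu>:]:]:]" for i
  proof -
    have "[:[:- \<sigma> i, 1:]:] = Y13 - inX3 (\<sigma> i)" by simp
    then show ?thesis by (simp only: dan_subst_diff dan_subst_Y1 dan_subst_inX) simp
  qed
  have P: "[:P:] = (\<Prod>i=1..r. [:[:- \<sigma> i, 1:]:])" by (simp only: dan_P_def prod_const_poly)
  have EP: "dan_subst ?u ?v ?w [:P:] = [:?N:]"
    by (simp only: P dan_subst_prod fac) (simp only: prod_const_poly)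
  have ud: "?u ^ d = [:[:[:0, a:] ^ d:]:]" by (simp add: poly_const_power)
  have ud': "?u ^ d * const3 (inverse a ^ d * \<mu> ^ r) = const3 (\<mu> ^ r) * X3 ^ d"
  proof -
    have k: "a ^ d * (inverse a ^ d * \<mu> ^ r) = \<mu> ^ r"
      using a by (simp only: mult.assoc[symmetric] power_mult_distrib[symmetric]) simp
    have "const3 a ^ d * const3 c = const3 (a ^ d * c)" for c
      by (simp add: poly_const_power)
    then have "const3 a ^ d * const3 (inverse a ^ d * \<mu> ^ r) = const3 (\<mu> ^ r)"
      by (simp only: k)
    moreover have "?u ^ d * const3 (inverse a ^ d * \<mu> ^ r) =
        (const3 a ^ d * const3 (inverse a ^ d * \<mu> ^ r)) * X3 ^ d"
      by (simp only: power_mult_distrib mult_ac)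
    ultimately show ?thesis by (simp only:)
  qed
  have "dan_subst ?u ?v ?w gen = ?u ^ d * ?w - [:?N:]"
    unfolding gen_def
    by (simp only: dan_subst_diff dan_subst_mult dan_subst_power dan_subst_X dan_subst_Y2 EP)
  also have "\<dots> = ?u ^ d * const3 (inverse a ^ d * \<mu> ^ r) * Y23 + (?u ^ d * [:Q:] - [:?N:])"
    by (simp only: distrib_left mult.assoc add_diff_eq)
  also have "?u ^ d * [:Q:] - [:?N:] = - (const3 (\<mu> ^ r) * [:P:])"
  proof -
    have "?u ^ d * [:Q:] = [:[:[:0, a:] ^ d:] * Q:]" unfolding ud by simp
    then show ?thesis unfolding Q by simp
  qed
  also have "?u ^ d * const3 (inverse a ^ d * \<mu> ^ r) * Y23 + - (const3 (\<mu> ^ r) * [:P:]) =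
      const3 (\<mu> ^ r) * gen"
    unfolding ud' gen_def by (simp only: right_diff_distrib mult.assoc add_uminus_conv_diff)
  finally show ?thesis .
qed

text \<open>The substitution scales \<open>gen\<close> by a constant, so it preserves the ideal and
  descends to the quotient.\<close>

lemma dan_aut_endo:
  assumes t: "(\<alpha>, \<mu>, a, b) \<in> data"
  shows "endo (dan_aut d r \<sigma> (\<alpha>, \<mu>, a, b))"
    and "acts (dan_aut d r \<sigma> (\<alpha>, \<mu>, a, b)) \<mu> a (dan_ctilde d \<sigma> (\<alpha>, \<mu>, a, b))"
proof -
  let ?\<phi> = "dan_aut d r \<sigma> (\<alpha>, \<mu>, a, b)"
  define ct where "ct = dan_ctilde d \<sigma> (\<alpha>, \<mu>, a, b)"
  define Q where "Q = ((\<Prod>i=1..r. [:ct - pcompose (\<sigma> i) [:0, a:], [:\<mu>:]:])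
                - [:[:\<mu> ^ r:]:] * (\<Prod>i=1..r. [:- \<sigma> i, 1:])) div [:[:0, a:] ^ d:]"
  define E where "E = dan_subst (const3 a * X3) (const3 \<mu> * Y13 + inX3 ct)
            (const3 (inverse a ^ d * \<mu> ^ r) * Y23 + [:Q:])"
  have \<phi>: "?\<phi> = dan_descend d P E"
    by (simp add: dan_aut_def E_def Q_def ct_def Let_def)
  have Egen: "E gen = const3 (\<mu> ^ r) * gen"
    unfolding E_def Q_def ct_def by (rule subst_gen[OF t])
  have E: "?\<phi> (cls p) = cls (E p)" for p
    unfolding \<phi>
  proof (rule descend_cls)
    fix p q :: "'k poly3" assume "gen dvd p - q"
    then obtain s where "p - q = gen * s" by (elim dvdE)
    then have "E p - E q = E gen * E s"
      unfolding E_def by (simp only: dan_subst_mult flip: dan_subst_diff)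
    then show "gen dvd E p - E q" unfolding Egen by (simp only: dvd_mult dvd_mult2 dvd_refl)
  qed
  have E1: "E 1 = 1" using dan_subst_const[of _ _ _ 1] unfolding E_def by (simp add: one_pCons)
  show "endo ?\<phi>"
    unfolding endo_def
  proof (intro conjI allI)
    show "?\<phi> \<in> ring_hom B B"
      by (auto simp: ring_hom_def carrier_B B_mult B_add B_one E E1)
         (simp_all add: E_def dan_subst_add dan_subst_mult)
    show "?\<phi> \<in> extensional (carrier B)" unfolding \<phi> by (rule descend_ext)
    show "?\<phi> (cls (const3 c)) = cls (const3 c)" for c
      unfolding E by (simp only: E_def dan_subst_const)
  qed
  show "acts ?\<phi> \<mu> a (dan_ctilde d \<sigma> (\<alpha>, \<mu>, a, b))"
    unfolding acts_def E ct_def[symmetric] by (simp only: E_def dan_subst_X dan_subst_Y1 simp_thms)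
qed

section \<open>Composition and inversion of automorphisms on the level of data\<close>

definition datum_mult ::
    "(nat \<Rightarrow> nat) \<times> 'k \<times> 'k \<times> 'k poly \<Rightarrow> (nat \<Rightarrow> nat) \<times> 'k \<times> 'k \<times> 'k poly \<Rightarrow>
     (nat \<Rightarrow> nat) \<times> 'k \<times> 'k \<times> 'k poly" where
  "datum_mult = (\<lambda>(\<alpha>, \<mu>, a, b) (\<beta>, \<nu>, a', b').
     (\<beta> \<circ> \<alpha>, \<nu> * \<mu>, a * a', smult \<nu> b + smult (a ^ d) (pcompose b' [:0, a:])))"

definition datum_inv ::
    "(nat \<Rightarrow> nat) \<times> 'k \<times> 'k \<times> 'k poly \<Rightarrow> (nat \<Rightarrow> nat) \<times> 'k \<times> 'k \<times> 'k poly" where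
  "datum_inv = (\<lambda>(\<alpha>, \<mu>, a, b). (Hilbert_Choice.inv \<alpha>, inverse \<mu>, inverse a,
     - smult (inverse \<mu> * inverse a ^ d) (pcompose b [:0, inverse a:])))"

lemma pcompose_scale: "pcompose (pcompose p [:0, a':]) [:0, a:] = pcompose p [:0, a * a':]"
  for a a' :: 'k
  by (simp flip: pcompose_assoc) (simp add: pcompose_pCons mult.commute)

text \<open>Inserting and removing \<nu> \<sigma>_{\<alpha>(i)}(aX) splits c into the contributions
  of the two factors. It also explains the order \<beta> \<circ> \<alpha>: the second datum is read
  at the index \<alpha>(i).\<close>

lemma dan_c_mult:
  "dan_c \<sigma> (\<beta> \<circ> \<alpha>) (\<nu> * \<mu>) (a * a') i =
     smult \<nu> (dan_c \<sigma> \<alpha> \<mu> a i) + pcompose (dan_c \<sigma> \<beta> \<nu> a' (\<alpha> i)) [:0, a:]"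
  unfolding dan_c_def pcompose_diff pcompose_smult pcompose_scale smult_diff_right
  by (simp add: mult.commute)

lemma datum_mult_data:
  assumes "t \<in> data" "t' \<in> data"
  shows "datum_mult t t' \<in> data"
proof -
  obtain \<alpha> \<mu> a b \<beta> \<nu> a' b' where t: "t = (\<alpha>, \<mu>, a, b)" "t' = (\<beta>, \<nu>, a', b')"
    by (metis prod_cases4)
  note \<alpha> = data_basic(1)[OF assms(1)[unfolded t]] and \<beta> = data_basic(1)[OF assms(2)[unfolded t]]
  have "dan_c \<sigma> (\<beta> \<circ> \<alpha>) (\<nu> * \<mu>) (a * a') i =
      smult \<nu> (dan_c \<sigma> \<alpha> \<mu> a 1) + pcompose (dan_c \<sigma> \<beta> \<nu> a' 1) [:0, a:]" if "i \<in> {1..r}" for i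
  proof -
    have \<alpha>i: "\<alpha> i \<in> {1..r}" by (rule permutes_in_image[OF \<alpha>, THEN iffD2, OF that])
    show ?thesis
      unfolding dan_c_mult dataD[OF assms(1)[unfolded t] that] dataD[OF assms(2)[unfolded t] \<alpha>i] ..
  qed
  moreover have "\<nu> * \<mu> \<noteq> 0" "a * a' \<noteq> 0"
    using assms[unfolded t, THEN data_basic(2)] assms[unfolded t, THEN data_basic(3)] by simp_all
  ultimately show ?thesis
    unfolding t datum_mult_def prod.case by (intro dataI permutes_compose[OF \<alpha> \<beta>])
qed

text \<open>The right-hand side is the translation found in \<open>acts_compose\<close>. The factor
  a^d in the last component of \<open>datum_mult\<close> comes from evaluating X^d b'(X) at
  aX.\<close>

lemma ctilde_mult:
  assumes "(\<alpha>, \<mu>, a, b) \<in> data" "(\<beta>, \<nu>, a', b') \<in> data"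
  shows "dan_ctilde d \<sigma> (datum_mult (\<alpha>, \<mu>, a, b) (\<beta>, \<nu>, a', b')) =
    smult \<nu> (dan_ctilde d \<sigma> (\<alpha>, \<mu>, a, b)) + pcompose (dan_ctilde d \<sigma> (\<beta>, \<nu>, a', b')) [:0, a:]"
proof -
  note \<alpha> = data_basic(1)[OF assms(1)]
  have "\<alpha> 1 \<in> {1..r}" using permutes_in_image[OF \<alpha>, of 1] r_pos by simp
  then have c: "dan_c \<sigma> \<beta> \<nu> a' (\<alpha> 1) = dan_c \<sigma> \<beta> \<nu> a' 1" using dataD assms(2) by blast
  have X: "pcompose ([:0, 1:] ^ d) [:0, a:] = smult (a ^ d) ([:0, 1:] ^ d)"
  proof -
    have "pcompose ([:0, 1:] ^ d) [:0, a:] = ([:a:] * [:0, 1:]) ^ d"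
      by (induction d) (simp_all add: pcompose_mult pcompose_pCons pcompose_1)
    then show ?thesis by (simp only: power_mult_distrib poly_const_power) simp
  qed
  show ?thesis
    by (simp add: datum_mult_def dan_ctilde_def dan_c_mult c pcompose_add pcompose_mult X
      smult_add_right distrib_left del: One_nat_def)
qed

lemma datum_inv_data:
  assumes "t \<in> data" shows "datum_inv t \<in> data"
proof -
  obtain \<alpha> \<mu> a b where t: "t = (\<alpha>, \<mu>, a, b)" by (metis prod_cases4)
  note \<alpha> = data_basic(1)[OF assms[unfolded t]] and nz = data_basic(2-)[OF assms[unfolded t]]
  have "dan_c \<sigma> (Hilbert_Choice.inv \<alpha>) (inverse \<mu>) (inverse a) j =
      - smult (inverse \<mu>) (pcompose (dan_c \<sigma> \<alpha> \<mu> a 1) [:0, inverse a:])" if "j \<in> {1..r}" for j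
  proof -
    define i where "i = Hilbert_Choice.inv \<alpha> j"
    have i: "i \<in> {1..r}" "\<alpha> i = j"
      using that permutes_in_image[OF permutes_inv[OF \<alpha>]] permutes_inverses[OF \<alpha>]
      by (simp_all add: i_def del: One_nat_def)
    have c: "dan_c \<sigma> \<alpha> \<mu> a 1 = dan_c \<sigma> \<alpha> \<mu> a i" using dataD[OF assms[unfolded t] i(1)] ..
    show ?thesis unfolding c unfolding dan_c_def pcompose_diff pcompose_smult pcompose_scale smult_diff_right
        i_def[symmetric] i(2)
      using nz by simp
  qed
  moreover have "inverse \<mu> \<noteq> 0" "inverse a \<noteq> 0" using nz by auto
  ultimately show ?thesis
    unfolding t datum_inv_def prod.case by (intro dataI permutes_inv[OF \<alpha>])
qed

lemma datum_inv:
  assumes "t \<in> data"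
  shows "datum_mult t (datum_inv t) = (id, 1, 1, 0)" "datum_mult (datum_inv t) t = (id, 1, 1, 0)"
proof -
  obtain \<alpha> \<mu> a b where t: "t = (\<alpha>, \<mu>, a, b)" by (metis prod_cases4)
  note \<alpha> = data_basic(1)[OF assms[unfolded t]] and nz = data_basic(2-)[OF assms[unfolded t]]
  then show "datum_mult t (datum_inv t) = (id, 1, 1, 0)" "datum_mult (datum_inv t) t = (id, 1, 1, 0)"
    using permutes_inv_o[OF \<alpha>]
    by (simp_all add: t datum_mult_def datum_inv_def pcompose_smult pcompose_uminus pcompose_scale
      power_inverse power_mult_distrib[symmetric] field_simps)
qed

lemma unit_data: "(id, 1, 1, b) \<in> data"
  unfolding data_iff by (simp add: dan_c_def permutes_id)

lemma \<Phi>_one: "\<Phi> (id, 1, 1, 0) = idB"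
proof (rule endo_eqI[OF dan_aut_endo(1) endo_id _ acts_id])
  show "acts (\<Phi> (id, 1, 1, 0)) 1 1 0"
    using dan_aut_endo(2)[OF unit_data, of 0] by (simp add: dan_ctilde_def dan_c_def)
qed (simp_all add: unit_data)

lemma \<Phi>_compose:
  assumes "t \<in> data" "t' \<in> data"
  shows "compose (carrier B) (\<Phi> t) (\<Phi> t') = \<Phi> (datum_mult t t')"
proof -
  obtain \<alpha> \<mu> a b \<beta> \<nu> a' b' where t: "t = (\<alpha>, \<mu>, a, b)" "t' = (\<beta>, \<nu>, a', b')"
    by (metis prod_cases4)
  note t_data = assms[unfolded t] and c_data = datum_mult_data[OF assms, unfolded t]
  note E = dan_aut_endo[OF t_data(1)] dan_aut_endo[OF t_data(2)]
  have mult: "datum_mult (\<alpha>, \<mu>, a, b) (\<beta>, \<nu>, a', b') = (\<beta> \<circ> \<alpha>, \<nu> * \<mu>, a * a',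
      smult \<nu> b + smult (a ^ d) (pcompose b' [:0, a:]))" by (simp add: datum_mult_def)
  note E' = dan_aut_endo[OF c_data[unfolded mult], folded mult, unfolded ctilde_mult[OF t_data]]
  have "a * a' \<noteq> 0" using t_data[THEN data_basic(3)] by simp
  then show ?thesis unfolding t
    by (intro endo_eqI[OF endo_compose[OF E(1,3)] E'(1) acts_compose[OF E(1,2,4)] E'(2)])
qed

text \<open>The endomorphism of the inverse datum is a two-sided inverse, by the composition rule
  already available for endomorphisms.\<close>

lemma \<Phi>_carrier:
  assumes "t \<in> data" shows "\<Phi> t \<in> carrier A"
proof -
  let ?\<phi> = "\<Phi> t" and ?\<psi> = "\<Phi> (datum_inv t)"
  have endo: "endo (\<Phi> s)" if "s \<in> data" for s
    using dan_aut_endo(1) that by (metis prod_cases4)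
  have cl: "\<Phi> s x \<in> carrier B" if "s \<in> data" "x \<in> carrier B" for s x
    using endo[OF that(1)] that(2) ring_hom_closed[of "\<Phi> s" B B x] by (simp add: endo_def)
  have inv: "?\<phi> (?\<psi> x) = x" "?\<psi> (?\<phi> x) = x" if "x \<in> carrier B" for x
    using that \<Phi>_compose[OF assms datum_inv_data[OF assms]]
      \<Phi>_compose[OF datum_inv_data[OF assms] assms] datum_inv[OF assms]
    by (metis \<Phi>_one compose_eq idB_def restrict_apply')+
  have "bij_betw ?\<phi> (carrier B) (carrier B)"
    by (rule bij_betwI[where g = ?\<psi>]) (use inv cl assms datum_inv_data in auto)
  then show ?thesis using endo[OF assms] by (simp add: carrier_A)
qed

lemma \<Phi>_mult:
  assumes "t \<in> data" "t' \<in> data" shows "\<Phi> t \<otimes>\<^bsub>A\<^esub> \<Phi> t' = \<Phi> (datum_mult t t')"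
  using assms \<Phi>_carrier A_mult \<Phi>_compose by simp

lemma \<Phi>_inv:
  assumes "t \<in> data" shows "inv\<^bsub>A\<^esub> (\<Phi> t) = \<Phi> (datum_inv t)"
proof -
  interpret group A by (rule group_A)
  show ?thesis
    by (rule inv_equality)
       (use assms datum_inv_data datum_inv \<Phi>_mult \<Phi>_carrier \<Phi>_one A_one in auto)
qed

lemma \<Phi>_eqD:
  assumes "(\<alpha>, \<mu>, a, b) \<in> data" "(\<beta>, \<nu>, a', b') \<in> data" "\<Phi> (\<alpha>, \<mu>, a, b) = \<Phi> (\<beta>, \<nu>, a', b')"
  shows "\<mu> = \<nu> \<and> a = a' \<and> dan_ctilde d \<sigma> (\<alpha>, \<mu>, a, b) = dan_ctilde d \<sigma> (\<beta>, \<nu>, a', b')"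
  using acts_unique dan_aut_endo(2) assms by metis

text \<open>In characteristic zero, averaging over the roots \<open>\<sigma>\<^sub>i\<close> kills a translation permuting them.\<close>

lemma dan_c_trivial:
  assumes "(\<alpha>, 1, 1, b) \<in> data" shows "dan_c \<sigma> \<alpha> 1 1 1 = 0"
proof -
  note \<alpha> = data_basic(1)[OF assms]
  have "of_nat r * dan_c \<sigma> \<alpha> 1 1 1 = (\<Sum>i=1..r. dan_c \<sigma> \<alpha> 1 1 1)" by simp
  also have "\<dots> = (\<Sum>i=1..r. dan_c \<sigma> \<alpha> 1 1 i)"
    by (intro sum.cong refl dataD[OF assms, symmetric])
  also have "\<dots> = (\<Sum>i=1..r. \<sigma> (\<alpha> i)) - (\<Sum>i=1..r. \<sigma> i)"
    by (simp add: dan_c_def sum_subtractf)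
  also have "\<dots> = 0" using sum.permute[OF \<alpha>, of \<sigma>] by (simp add: o_def)
  finally show ?thesis using r_pos by auto
qed

section \<open>The derivation\<close>

definition DD :: "'k poly3 \<Rightarrow> 'k poly3" where
  "DD p = X3 ^ d * map_poly pderiv p + [:pderiv P:] * pderiv p"

lemma DD_add: "DD (p + q) = DD p + DD q"
  by (simp add: DD_def map_poly_pderiv_add pderiv_add distrib_left add_ac
    del: mult_pCons_left mult_pCons_right)

lemma DD_mult: "DD (p * q) = DD p * q + p * DD q"
proof -
  have "DD (p * q) = X3 ^ d * (map_poly pderiv p * q + p * map_poly pderiv q) +
      [:pderiv P:] * (pderiv p * q + p * pderiv q)"
    unfolding DD_def map_poly_pderiv_mult pderiv_mult by (simp only: mult_ac add_ac)
  then show ?thesis unfolding DD_def by (simp only: distrib_left distrib_right mult_ac add_ac)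
qed

lemma DD_inX: "DD (inX3 s) = 0" and DD_Y1: "DD Y13 = X3 ^ d"
  by (simp_all add: DD_def map_poly_pCons pderiv_pCons one_pCons[symmetric])

lemma DD_gen: "DD gen = 0"
proof -
  have "map_poly pderiv gen = [:- pderiv P:]" "pderiv gen = X3 ^ d"
    by (simp_all add: gen_pCons map_poly_pCons pderiv_pCons pderiv_minus poly_const_power)
  then show ?thesis unfolding DD_def by simp
qed

lemma delta_cls: "dan_delta d P f (cls p) = cls (inX3 f * DD p)"
proof -
  have "dan_D d P (cls p) = cls (DD p)"
    unfolding dan_D_def DD_def[symmetric]
  proof (rule descend_cls)
    fix p q :: "'k poly3" assume "gen dvd p - q"
    then obtain s where "p - q = gen * s" by (elim dvdE)
    then have "p = q + gen * s" by (simp only: diff_eq_eq add.commute)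
    then have "DD p - DD q = gen * DD s"
      by (simp only: DD_add DD_mult DD_gen add_diff_cancel_left' mult_zero_left add_0)
    then show "gen dvd DD p - DD q" by (simp only: dvd_triv_left)
  qed
  then show ?thesis by (simp add: dan_delta_def B_mult del: mult_pCons_left mult_pCons_right)
qed

text \<open>Necessity is the comparison at y_1, where X^d cancels in k[X]. For sufficiency, both
  composites of \<phi> and \<delta> obey the same Leibniz rule twisted by \<phi>, so agreement
  passes from generators to all of B; y_2 is treated through x^d y_2 = P.\<close>

lemma commute_iff:
  assumes \<phi>: "endo \<phi>" "acts \<phi> \<mu> a e" and a: "a \<noteq> 0"
  shows "(\<forall>b\<in>carrier B. \<phi> (dan_delta d P f b) = dan_delta d P f (\<phi> b)) \<longleftrightarrow>
    smult (a ^ d) (pcompose f [:0, a:]) = smult \<mu> f"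
proof -
  let ?\<delta> = "dan_delta d P f"
  have DX: "DD (const3 a * X3) = 0" using DD_inX[of "[:0, a:]"] by simp
  have fX: "\<phi> (cls (inX3 f * p)) = cls (inX3 (pcompose f [:0, a:]) * p')"
    if "\<phi> (cls p) = cls p'" for p p'
    by (rule endo_mult[OF \<phi>(1) acts_inX[OF \<phi>] that])
  have Xd: "\<phi> (cls (X3 ^ d)) = cls ((const3 a * X3) ^ d)"
    by (rule endo_power[OF \<phi>(1)]) (use \<phi>(2) in \<open>simp only: acts_def\<close>)
  have lhs: "\<phi> (?\<delta> (cls Y13)) = cls (inX3 (pcompose f [:0, a:]) * (const3 a * X3) ^ d)"
    unfolding delta_cls DD_Y1 by (rule fX[OF Xd])
  have DDY: "DD (const3 \<mu> * Y13 + inX3 e) = const3 \<mu> * X3 ^ d"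
    by (simp only: DD_add DD_mult DD_inX DD_Y1) simp
  have rhs: "?\<delta> (\<phi> (cls Y13)) = cls (inX3 f * (const3 \<mu> * X3 ^ d))"
  proof -
    have "\<phi> (cls Y13) = cls (const3 \<mu> * Y13 + inX3 e)" using \<phi>(2) by (simp only: acts_def)
    then show ?thesis by (simp only: delta_cls DDY)
  qed
  have Y: "\<phi> (?\<delta> (cls Y13)) = ?\<delta> (\<phi> (cls Y13)) \<longleftrightarrow>
      smult (a ^ d) (pcompose f [:0, a:]) = smult \<mu> f"
  proof -
    have l: "inX3 (pcompose f [:0, a:]) * (const3 a * X3) ^ d =
        [:[:[:0, 1:] ^ d * smult (a ^ d) (pcompose f [:0, a:]):]:]"
      by (simp only: power_mult_distrib) (simp add: poly_const_power mult.commute)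
    have r: "inX3 f * (const3 \<mu> * X3 ^ d) = [:[:[:0, 1:] ^ d * smult \<mu> f:]:]"
      by (simp add: poly_const_power mult.commute)
    have "[:0, 1:] ^ d * u = [:0, 1:] ^ d * v \<longleftrightarrow> u = v" for u v :: "'k poly"
      by (subst mult_left_cancel) simp_all
    then show ?thesis unfolding lhs rhs l r cls_inj pCons_eq_iff by (simp only: simp_thms)
  qed
  have all: "\<phi> (?\<delta> (cls p)) = ?\<delta> (\<phi> (cls p))"
    if base: "smult (a ^ d) (pcompose f [:0, a:]) = smult \<mu> f" for p
  proof -
    let ?Q = "\<lambda>p. \<phi> (?\<delta> (cls p)) = ?\<delta> (\<phi> (cls p))"
    have zero: "\<phi> (cls 0) = cls 0" using endo_const[OF \<phi>(1), of 0] by simp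
    have const: "?Q (const3 c)" for c
      using DD_inX[of "[:c:]"] zero by (simp add: delta_cls endo_const[OF \<phi>(1)])
    have X: "?Q X3"
    proof -
      have "\<phi> (cls X3) = cls (const3 a * X3)" using \<phi>(2) by (simp only: acts_def)
      then have "?\<delta> (\<phi> (cls X3)) = cls 0" by (simp only: delta_cls DX mult_zero_right)
      moreover have "\<phi> (?\<delta> (cls X3)) = cls 0"
        by (simp only: delta_cls DD_inX mult_zero_right zero)
      ultimately show ?thesis by simp
    qed
    have add: "?Q (p + q)" if "?Q p" "?Q q" for p q
    proof -
      obtain p' q' where p': "\<phi> (cls p) = cls p'" and q': "\<phi> (cls q) = cls q'"
        using endo_ex \<phi>(1) by metis
      have "\<phi> (?\<delta> (cls (p + q))) = cls (inX3 f * DD p' + inX3 f * DD q')"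
        unfolding delta_cls DD_add distrib_left
        by (rule endo_add[OF \<phi>(1)]) (use that in \<open>simp_all only: p' q' delta_cls\<close>)
      then show ?thesis
        by (simp only: endo_add[OF \<phi>(1) p' q'] delta_cls DD_add distrib_left)
    qed
    \<comment> \<open>The rule is stated for arbitrary representatives of the two derivatives,
      without assuming commutation at p and q: it is also applied to x^d y_2, where commutation at
      y_2 is still to be shown.\<close>
    have mult_eq: "\<phi> (?\<delta> (cls (p * q))) = cls ((x * q') + (p' * y))"
      if "\<phi> (?\<delta> (cls p)) = cls x" "\<phi> (?\<delta> (cls q)) = cls y"
        "\<phi> (cls p) = cls p'" "\<phi> (cls q) = cls q'" for p q p' q' x y
    proof -
      have "inX3 f * DD (p * q) = (inX3 f * DD p) * q + p * (inX3 f * DD q)"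
        by (simp only: DD_mult distrib_left mult_ac)
      then show ?thesis using that unfolding delta_cls
        by (simp only:) (intro endo_add[OF \<phi>(1)] endo_mult[OF \<phi>(1)])
    qed
    have delta_mult: "?\<delta> (cls (p * q)) = cls ((inX3 f * DD p) * q + p * (inX3 f * DD q))" for p q
      by (simp only: delta_cls DD_mult distrib_left mult_ac)
    have mult: "?Q (p * q)" if "?Q p" "?Q q" for p q
    proof -
      obtain p' q' where p': "\<phi> (cls p) = cls p'" and q': "\<phi> (cls q) = cls q'"
        using endo_ex \<phi>(1) by metis
      have "\<phi> (?\<delta> (cls (p * q))) = cls ((inX3 f * DD p') * q' + p' * (inX3 f * DD q'))"
        by (rule mult_eq) (use that in \<open>simp_all only: p' q' delta_cls\<close>)
      then show ?thesis by (simp only: endo_mult[OF \<phi>(1) p' q'] delta_mult)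
    qed
    have two: "?Q [:q:]" for q
      by (rule poly2_induct) (use const X Y base add mult in blast)+
    have Y2: "?Q Y23"
    proof -
      obtain w where w: "\<phi> (cls Y23) = cls w" using endo_ex \<phi>(1) by metis
      obtain z where z: "\<phi> (?\<delta> (cls Y23)) = cls z" using endo_ex \<phi>(1) unfolding delta_cls by metis
      let ?u = "const3 a * X3"
      have X0: "DD (X3 ^ d) = 0" and u0: "DD (?u ^ d) = 0"
        using DD_inX[of "[:0, 1:] ^ d"] DD_inX[of "[:0, a:] ^ d"] by (simp_all add: poly_const_power)
      have "\<phi> (?\<delta> (cls (X3 ^ d))) = cls 0"
        by (simp only: delta_cls X0 mult_zero_right zero)
      from mult_eq[OF this z Xd w]
      have 1: "\<phi> (?\<delta> (cls (X3 ^ d * Y23))) = cls (?u ^ d * z)" by (simp only: mult_zero_left add_0)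
      have 2: "?\<delta> (\<phi> (cls (X3 ^ d * Y23))) = cls (?u ^ d * (inX3 f * DD w))"
        unfolding endo_mult[OF \<phi>(1) Xd w] delta_mult u0 by (simp only: mult_zero_right mult_zero_left add_0)
      \<comment> \<open>As \<delta> kills x^d and (ax)^d, each side of the Leibniz rule for x^d y_2
        has a single term left. The two sides agree because x^d y_2 is the class of P, an element of
        k[X,Y_1].\<close>
      have "cls (?u ^ d * z) = cls (?u ^ d * (inX3 f * DD w))"
        using two[of P] unfolding 1[symmetric] 2[symmetric] cls_rel .
      then have "cls z = cls (inX3 f * DD w)" by (rule cls_aX_cancel[OF a])
      then show ?thesis unfolding z w unfolding delta_cls .
    qed
    show ?thesis
      by (rule poly3_induct) (use const X Y base Y2 add mult in blast)+
  qed
  show ?thesis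
  proof
    assume "\<forall>b\<in>carrier B. \<phi> (?\<delta> b) = ?\<delta> (\<phi> b)"
    then show "smult (a ^ d) (pcompose f [:0, a:]) = smult \<mu> f" using Y cls_carrier by blast
  qed (auto simp: carrier_B all)
qed

section \<open>The isotropy group and its intersections with U and S\<close>

abbreviation "Iso f \<equiv> dan_isotropy d P (dan_delta d P f)"

lemma isotropy_iff:
  assumes "(\<alpha>, \<mu>, a, b) \<in> data"
  shows "\<Phi> (\<alpha>, \<mu>, a, b) \<in> Iso f \<longleftrightarrow> smult (a ^ d) (pcompose f [:0, a:]) = smult \<mu> f"
  unfolding dan_isotropy_def mem_Collect_eq
    commute_iff[OF dan_aut_endo[OF assms] data_basic(3)[OF assms]]
  using \<Phi>_carrier[OF assms] by blast

lemma delta_carrier: "x \<in> carrier B \<Longrightarrow> dan_delta d P f x \<in> carrier B"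
  by (auto simp: carrier_B delta_cls)

lemma A_apply_closed: "\<phi> \<in> carrier A \<Longrightarrow> x \<in> carrier B \<Longrightarrow> \<phi> x \<in> carrier B"
  unfolding carrier_A bij_betw_def by blast

lemma IsoD:
  assumes "\<phi> \<in> Iso f"
  shows "\<phi> \<in> carrier A" "\<And>x. x \<in> carrier B \<Longrightarrow> \<phi> (dan_delta d P f x) = dan_delta d P f (\<phi> x)"
  using assms unfolding dan_isotropy_def by blast+

lemma subgroup_Iso: "subgroup (Iso f) A"
proof -
  interpret group A by (rule group_A)
  let ?\<delta> = "dan_delta d P f"
  show ?thesis
  proof (rule subgroupI)
    show "Iso f \<subseteq> carrier A" using IsoD(1) by blast
    have "idB (?\<delta> x) = ?\<delta> (idB x)" if "x \<in> carrier B" for x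
      using that delta_carrier[OF that] by (simp add: idB_def)
    then have "idB \<in> Iso f" using one_closed unfolding A_one dan_isotropy_def by blast
    then show "Iso f \<noteq> {}" by blast
  next
    fix \<phi> assume \<phi>: "\<phi> \<in> Iso f"
    let ?\<psi> = "inv\<^bsub>A\<^esub> \<phi>"
    note \<phi>A = IsoD(1)[OF \<phi>] and \<psi>A = inv_closed[OF IsoD(1)[OF \<phi>]]
    have 1: "\<phi> (?\<psi> x) = x" if "x \<in> carrier B" for x
      using r_inv[OF \<phi>A] that unfolding A_mult[OF \<phi>A \<psi>A] A_one by (metis compose_eq idB_def restrict_apply')
    have 2: "?\<psi> (\<phi> x) = x" if "x \<in> carrier B" for x
      using l_inv[OF \<phi>A] that unfolding A_mult[OF \<psi>A \<phi>A] A_one by (metis compose_eq idB_def restrict_apply')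
    have "?\<psi> (?\<delta> x) = ?\<delta> (?\<psi> x)" if "x \<in> carrier B" for x
    proof -
      note c = A_apply_closed[OF \<psi>A that]
      have "?\<delta> x = \<phi> (?\<delta> (?\<psi> x))" unfolding IsoD(2)[OF \<phi> c] 1[OF that] ..
      then show ?thesis using 2[OF delta_carrier[OF c]] by simp
    qed
    then show "?\<psi> \<in> Iso f" using \<psi>A unfolding dan_isotropy_def by blast
  next
    fix \<phi> \<psi> assume \<phi>: "\<phi> \<in> Iso f" and \<psi>: "\<psi> \<in> Iso f"
    note \<phi>A = IsoD(1)[OF \<phi>] and \<psi>A = IsoD(1)[OF \<psi>]
    have "(\<phi> \<otimes>\<^bsub>A\<^esub> \<psi>) (?\<delta> x) = ?\<delta> ((\<phi> \<otimes>\<^bsub>A\<^esub> \<psi>) x)" if "x \<in> carrier B" for x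
      unfolding A_mult[OF \<phi>A \<psi>A] compose_eq[OF that] compose_eq[OF delta_carrier[OF that]]
        IsoD(2)[OF \<psi> that] IsoD(2)[OF \<phi> A_apply_closed[OF \<psi>A that]] ..
    then show "\<phi> \<otimes>\<^bsub>A\<^esub> \<psi> \<in> Iso f"
      using m_closed[OF \<phi>A \<psi>A] unfolding dan_isotropy_def by blast
  qed
qed

lemma U_subset_Iso: "dan_U d r \<sigma> \<subseteq> Iso f"
proof
  fix \<phi> assume "\<phi> \<in> dan_U d r \<sigma>"
  then obtain b where "\<phi> = \<Phi> (id, 1, 1, b)" by (auto simp: dan_U_def)
  then show "\<phi> \<in> Iso f" using isotropy_iff[OF unit_data] by simp
qed

text \<open>With a = 1 the criterion reads f = \<mu> f, so \<mu> = 1. The permutation can still be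
  nontrivial when roots coincide, but averaging makes the translation vanish and the automorphism is
  the identity.\<close>

lemma S_Iso:
  assumes "f \<noteq> 0" shows "dan_S d r \<sigma> \<inter> Iso f = {\<one>\<^bsub>A\<^esub>}"
proof (intro equalityI subsetI)
  fix \<phi> assume \<phi>: "\<phi> \<in> dan_S d r \<sigma> \<inter> Iso f"
  then obtain \<alpha> \<mu> where \<phi>_eq: "\<phi> = \<Phi> (\<alpha>, \<mu>, 1, 0)" and t: "(\<alpha>, \<mu>, 1, 0) \<in> data"
    by (auto simp: dan_S_def)
  have "smult 1 f = smult \<mu> f" using \<phi> isotropy_iff[OF t, of f] unfolding \<phi>_eq by simp
  then have "smult (1 - \<mu>) f = 0" by (simp add: smult_diff_left)
  then have \<mu>: "\<mu> = 1" using assms by simp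
  note t = t[unfolded \<mu>]
  have "acts (\<Phi> (\<alpha>, 1, 1, 0)) 1 1 0"
    using dan_aut_endo(2)[OF t] dan_c_trivial[OF t] by (simp add: dan_ctilde_def)
  then have "\<phi> = idB"
    unfolding \<phi>_eq \<mu> by (intro endo_eqI[OF dan_aut_endo(1)[OF t] endo_id _ acts_id]) simp_all
  then show "\<phi> \<in> {\<one>\<^bsub>A\<^esub>}" by (simp add: A_one)
next
  fix \<phi> assume "\<phi> \<in> {\<one>\<^bsub>A\<^esub>}"
  then have "\<phi> = \<Phi> (id, 1, 1, 0)" by (simp add: A_one \<Phi>_one)
  then show "\<phi> \<in> dan_S d r \<sigma> \<inter> Iso f"
    using unit_data[of 0] isotropy_iff[OF unit_data] by (auto simp: dan_S_def)
qed

section \<open>The torus part\<close>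

abbreviation "Ha \<equiv> dan_Ha d r \<sigma>"

lemma Ha_data_mult:
  assumes "(id, 1, a, 0) \<in> data" "(id, 1, a', 0) \<in> data"
  shows "Ha a \<otimes>\<^bsub>A\<^esub> Ha a' = Ha (a * a')"
  unfolding dan_Ha_def \<Phi>_mult[OF assms] by (simp add: datum_mult_def)

lemma Ha_one: "Ha 1 = \<one>\<^bsub>A\<^esub>"
  unfolding dan_Ha_def A_one by (rule \<Phi>_one)

lemma Ha_inj:
  assumes "(id, 1, a, 0) \<in> data" "(id, 1, a', 0) \<in> data" "Ha a = Ha a'"
  shows "a = a'"
  using \<Phi>_eqD[OF assms(1,2) assms(3)[unfolded dan_Ha_def]] by blast

lemma Ha_carrier: "(id, 1, a, 0) \<in> data \<Longrightarrow> Ha a \<in> carrier A"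
  unfolding dan_Ha_def by (rule \<Phi>_carrier)

text \<open>The map a to \<open>Ha a\<close> is an injective homomorphism on the n-th roots of
  unity, so the group and its generators are transported from the powers of w.\<close>

lemma cyclic_torus:
  fixes w :: 'k
  assumes n: "n \<ge> 1" and w: "primitive_root_of_unity n w"
    and data: "\<And>a. a ^ n = 1 \<Longrightarrow> (id, 1, a, 0) \<in> data"
    and K: "K = {Ha a | a. a ^ n = 1}" and K_sub: "subgroup K A"
  shows "A\<lparr>carrier := K\<rparr> \<cong> integer_mod_group n"
    and "{g \<in> K. generate A {g} = K} = {Ha a | a. primitive_root_of_unity n a}"
proof -
  interpret group A by (rule group_A)
  have wn: "w ^ n = 1" using w by (simp add: primitive_root_of_unity_def)
  have w_pow: "(w ^ j) ^ n = 1" for j by (metis wn mult.commute power_mult power_one)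
  have one_pow: "a ^ n = 1 \<Longrightarrow> (a ^ j) ^ n = 1" for a :: 'k and j
    by (metis mult.commute power_mult power_one)
  have pow: "Ha a [^]\<^bsub>A\<^esub> j = Ha (a ^ j)" if "a ^ n = 1" for a and j :: nat
  proof (induction j)
    case 0
    show ?case by (simp add: Ha_one)
  next
    case (Suc j)
    show ?case
      unfolding nat_pow_Suc Suc Ha_data_mult[OF data[OF one_pow[OF that]] data[OF that]]
      by (simp only: power_Suc mult.commute)
  qed
  \<comment> \<open>The carrier of \<open>integer_mod_group n\<close> consists of the integers from
    0 to n - 1, hence \<open>nat\<close>; the reduction modulo n in its addition is absorbed by w^n
    = 1.\<close>
  let ?h = "\<lambda>k. Ha (w ^ nat k)"
  have "?h \<in> iso (integer_mod_group n) (A\<lparr>carrier := K\<rparr>)"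
    unfolding iso_def
  proof (intro CollectI conjI)
    show "?h \<in> hom (integer_mod_group n) (A\<lparr>carrier := K\<rparr>)"
    proof (rule homI)
      fix k show "?h k \<in> carrier (A\<lparr>carrier := K\<rparr>)" unfolding K using w_pow by auto
    next
      fix i j assume "i \<in> carrier (integer_mod_group n)" "j \<in> carrier (integer_mod_group n)"
      then have ij: "0 \<le> i" "0 \<le> j" using n by (auto simp: carrier_integer_mod_group)
      have m: "i \<otimes>\<^bsub>integer_mod_group n\<^esub> j = (i + j) mod int n"
        using n by (simp add: integer_mod_group_def)
      have nat: "nat ((i + j) mod int n) = (nat i + nat j) mod n"
        using ij by (simp add: nat_mod_distrib nat_add_distrib)
      have "w ^ (nat i + nat j) = w ^ (n * ((nat i + nat j) div n) + (nat i + nat j) mod n)" by simp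
      also have "\<dots> = w ^ ((nat i + nat j) mod n)" unfolding power_add power_mult wn by simp
      finally have "w ^ nat ((i + j) mod int n) = w ^ nat i * w ^ nat j"
        unfolding nat power_add by simp
      then show "?h (i \<otimes>\<^bsub>integer_mod_group n\<^esub> j) = ?h i \<otimes>\<^bsub>A\<lparr>carrier := K\<rparr>\<^esub> ?h j"
        unfolding m by (simp add: Ha_data_mult[OF data[OF w_pow] data[OF w_pow]])
    qed
    show "bij_betw ?h (carrier (integer_mod_group n)) (carrier (A\<lparr>carrier := K\<rparr>))"
    proof (rule bij_betw_imageI)
      show "inj_on ?h (carrier (integer_mod_group n))"
      proof (rule linorder_inj_onI)
        fix i j assume ij: "i < j" "i \<in> carrier (integer_mod_group n)" "j \<in> carrier (integer_mod_group n)"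
        then have b: "0 \<le> i" "j < int n" using n by (auto simp: carrier_integer_mod_group)
        show "?h i \<noteq> ?h j"
        proof
          assume "?h i = ?h j"
          then have eq: "w ^ nat i = w ^ nat j" by (rule Ha_inj[OF data[OF w_pow] data[OF w_pow]])
          have "w ^ nat j = w ^ nat i * w ^ (nat j - nat i)" using ij b by (simp flip: power_add)
          moreover have "w \<noteq> 0" using data[OF wn] data_basic(3) by blast
          ultimately have "w ^ (nat j - nat i) = 1" using eq by simp
          then have "n dvd nat j - nat i" using primitive_root_power_eq_1_iff[OF w] by blast
          then have "n \<le> nat j - nat i" by (rule dvd_imp_le) (use ij b in linarith)
          then show False using ij b by linarith
        qed
      qed auto
      show "?h ` carrier (integer_mod_group n) = carrier (A\<lparr>carrier := K\<rparr>)"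
      proof (intro equalityI subsetI)
        fix g assume "g \<in> carrier (A\<lparr>carrier := K\<rparr>)"
        then obtain a where a: "a ^ n = 1" "g = Ha a" unfolding K by auto
        obtain j where j: "j < n" "a = w ^ j" using roots_of_unity_powers[OF w a(1)] by blast
        show "g \<in> ?h ` carrier (integer_mod_group n)"
          by (rule image_eqI[of _ _ "int j"]) (use a j n in \<open>simp_all add: carrier_integer_mod_group\<close>)
      qed (use w_pow in \<open>auto simp: K\<close>)
    qed
  qed
  then have "integer_mod_group n \<cong> A\<lparr>carrier := K\<rparr>" unfolding is_iso_def by blast
  then show "A\<lparr>carrier := K\<rparr> \<cong> integer_mod_group n"
    by (rule group.iso_sym[OF group_integer_mod_group])
  show "{g \<in> K. generate A {g} = K} = {Ha a | a. primitive_root_of_unity n a}"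
  proof (intro equalityI subsetI)
    fix g assume "g \<in> {g \<in> K. generate A {g} = K}"
    then obtain a where a: "a ^ n = 1" "g = Ha a" and gen: "generate A {g} = K" unfolding K by auto
    have gA: "g \<in> carrier A" unfolding a(2) by (rule Ha_carrier[OF data[OF a(1)]])
    have "Ha w \<in> generate A {g}" unfolding gen K using wn by blast
    then obtain k :: int where k: "Ha w = g [^]\<^bsub>A\<^esub> k" unfolding generate_pow[OF gA] by blast
    \<comment> \<open>Since \<open>Ha w\<close> is an integer power of the generator, a^q = 1 would
      give w^q = 1 with 0 < q < n.\<close>
    have "a ^ q \<noteq> 1" if q: "q \<in> {1..<n}" for q
    proof
      assume aq: "a ^ q = 1"
      have "Ha (w ^ q) = Ha w [^]\<^bsub>A\<^esub> int q" using pow[OF wn, of q] by (simp add: int_pow_int)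
      also have "\<dots> = (g [^]\<^bsub>A\<^esub> int q) [^]\<^bsub>A\<^esub> k"
        unfolding k int_pow_pow[OF gA] by (simp add: mult.commute)
      also have "g [^]\<^bsub>A\<^esub> int q = \<one>\<^bsub>A\<^esub>" using pow[OF a(1), of q] aq a(2) by (simp add: int_pow_int Ha_one)
      finally have "Ha (w ^ q) = Ha 1" by (simp add: Ha_one)
      then have "w ^ q = 1" by (rule Ha_inj[OF data[OF w_pow] data[OF power_one]])
      then show False using w q by (simp add: primitive_root_of_unity_def)
    qed
    then have "primitive_root_of_unity n a" using n a(1) by (simp add: primitive_root_of_unity_def)
    then show "g \<in> {Ha a | a. primitive_root_of_unity n a}" using a(2) by blast
  next
    fix g assume "g \<in> {Ha a | a. primitive_root_of_unity n a}"
    then obtain a where g: "g = Ha a" and a: "primitive_root_of_unity n a" by blast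
    have an: "a ^ n = 1" using a by (simp add: primitive_root_of_unity_def)
    have gK: "g \<in> K" unfolding K g using an by blast
    have gA: "g \<in> carrier A" unfolding g by (rule Ha_carrier[OF data[OF an]])
    have "K \<subseteq> generate A {g}"
    proof
      fix x assume "x \<in> K"
      then obtain z where z: "z ^ n = 1" "x = Ha z" unfolding K by blast
      obtain j where "z = a ^ j" using roots_of_unity_powers[OF a z(1)] by blast
      then have "x = g [^]\<^bsub>A\<^esub> int j" using z(2) pow[OF an, of j] g by (simp add: int_pow_int)
      then show "x \<in> generate A {g}" unfolding generate_pow[OF gA] by blast
    qed
    moreover have "generate A {g} \<subseteq> K" using generate_subgroup_incl[OF _ K_sub] gK by blast
    ultimately show "g \<in> {g \<in> K. generate A {g} = K}" using gK by blast
  qed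
qed

lemma subgroup_H: "subgroup (dan_H d r \<sigma>) A"
proof -
  interpret group A by (rule group_A)
  show ?thesis
  proof (rule subgroupI)
    show "dan_H d r \<sigma> \<subseteq> carrier A" using \<Phi>_carrier by (auto simp: dan_H_def)
    show "dan_H d r \<sigma> \<noteq> {}" using unit_data by (auto simp: dan_H_def)
  next
    fix x assume "x \<in> dan_H d r \<sigma>"
    then obtain a where x: "x = \<Phi> (id, 1, a, 0)" and a: "(id, 1, a, 0) \<in> data"
      by (auto simp: dan_H_def)
    have "datum_inv (id, 1, a, 0) = (id, 1, inverse a, 0)" by (simp add: datum_inv_def)
    then show "inv\<^bsub>A\<^esub> x \<in> dan_H d r \<sigma>"
      using \<Phi>_inv[OF a] datum_inv_data[OF a] unfolding x dan_H_def by auto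
  next
    fix x y assume "x \<in> dan_H d r \<sigma>" "y \<in> dan_H d r \<sigma>"
    then obtain a a' where x: "x = \<Phi> (id, 1, a, 0)" and a: "(id, 1, a, 0) \<in> data"
      and y: "y = \<Phi> (id, 1, a', 0)" and a': "(id, 1, a', 0) \<in> data"
      by (auto simp: dan_H_def)
    have "datum_mult (id, 1, a, 0) (id, 1, a', 0) = (id, 1, a * a', 0)" by (simp add: datum_mult_def)
    then show "x \<otimes>\<^bsub>A\<^esub> y \<in> dan_H d r \<sigma>"
      using \<Phi>_mult[OF a a'] datum_mult_data[OF a a'] unfolding x y dan_H_def by auto
  qed
qed

section \<open>The full isotropy group\<close>

lemma subgroup_U: "subgroup (dan_U d r \<sigma>) A"
proof -
  interpret group A by (rule group_A)
  show ?thesis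
  proof (rule subgroupI)
    show "dan_U d r \<sigma> \<subseteq> carrier A" using \<Phi>_carrier by (auto simp: dan_U_def)
    show "dan_U d r \<sigma> \<noteq> {}" using unit_data by (auto simp: dan_U_def)
  next
    fix x assume "x \<in> dan_U d r \<sigma>"
    then obtain b where x: "x = \<Phi> (id, 1, 1, b)" by (auto simp: dan_U_def)
    obtain b' where "datum_inv (id, 1, 1, b) = (id, 1, 1, b')" by (simp add: datum_inv_def)
    then show "inv\<^bsub>A\<^esub> x \<in> dan_U d r \<sigma>"
      using \<Phi>_inv[OF unit_data] unit_data unfolding x dan_U_def by auto
  next
    fix x y assume "x \<in> dan_U d r \<sigma>" "y \<in> dan_U d r \<sigma>"
    then obtain b b' where xy: "x = \<Phi> (id, 1, 1, b)" "y = \<Phi> (id, 1, 1, b')" by (auto simp: dan_U_def)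
    obtain c where "datum_mult (id, 1, 1, b) (id, 1, 1, b') = (id, 1, 1, c)" by (simp add: datum_mult_def)
    then show "x \<otimes>\<^bsub>A\<^esub> y \<in> dan_U d r \<sigma>"
      using \<Phi>_mult[OF unit_data unit_data] unit_data unfolding xy dan_U_def by auto
  qed
qed

text \<open>The permutation, \<mu> and a of a datum cancel against those of its inverse, so the
  conjugate has a datum (id, 1, 1, c'); the exact value of c' is irrelevant.\<close>

lemma U_conj:
  assumes t: "t \<in> data" and u: "u \<in> dan_U d r \<sigma>"
  shows "\<Phi> t \<otimes>\<^bsub>A\<^esub> u \<otimes>\<^bsub>A\<^esub> inv\<^bsub>A\<^esub> (\<Phi> t) \<in> dan_U d r \<sigma>"
proof -
  obtain \<alpha> \<mu> a b where t_eq: "t = (\<alpha>, \<mu>, a, b)" by (metis prod_cases4)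
  obtain c where u_eq: "u = \<Phi> (id, 1, 1, c)" using u by (auto simp: dan_U_def)
  note \<alpha> = data_basic(1)[OF t[unfolded t_eq]] and nz = data_basic(2-)[OF t[unfolded t_eq]]
  note m = datum_mult_data[OF t unit_data[of c]]
  have "\<exists>c'. datum_mult (datum_mult t (id, 1, 1, c)) (datum_inv t) = (id, 1, 1, c')"
    using nz permutes_inv_o(2)[OF \<alpha>] by (simp add: t_eq datum_mult_def datum_inv_def)
  then obtain c' where c': "datum_mult (datum_mult t (id, 1, 1, c)) (datum_inv t) = (id, 1, 1, c')" ..
  have "\<Phi> t \<otimes>\<^bsub>A\<^esub> u \<otimes>\<^bsub>A\<^esub> inv\<^bsub>A\<^esub> (\<Phi> t) = \<Phi> (id, 1, 1, c')"
    unfolding u_eq \<Phi>_inv[OF t] \<Phi>_mult[OF t unit_data] \<Phi>_mult[OF m datum_inv_data[OF t]] c' ..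
  then show ?thesis using unit_data by (auto simp: dan_U_def)
qed

text \<open>The automorphisms given by data with b = 0, which will turn out to be the product of H
  and S. Closure under products and inverses is immediate for this description.\<close>

definition T :: "('k poly3 set \<Rightarrow> 'k poly3 set) set" where
  "T = {\<Phi> (\<alpha>, \<mu>, a, 0) | \<alpha> \<mu> a. (\<alpha>, \<mu>, a, 0) \<in> data}"

lemma subgroup_T: "subgroup T A"
proof -
  interpret group A by (rule group_A)
  show ?thesis
  proof (rule subgroupI)
    show "T \<subseteq> carrier A" using \<Phi>_carrier by (auto simp: T_def)
    show "T \<noteq> {}" using unit_data by (auto simp: T_def)
  next
    fix x assume "x \<in> T"
    then obtain \<alpha> \<mu> a where x: "x = \<Phi> (\<alpha>, \<mu>, a, 0)" and t: "(\<alpha>, \<mu>, a, 0) \<in> data"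
      by (auto simp: T_def)
    have i: "datum_inv (\<alpha>, \<mu>, a, 0) = (Hilbert_Choice.inv \<alpha>, inverse \<mu>, inverse a, 0)"
      by (simp add: datum_inv_def)
    show "inv\<^bsub>A\<^esub> x \<in> T"
      using datum_inv_data[OF t] unfolding x \<Phi>_inv[OF t] T_def i by blast
  next
    fix x y assume "x \<in> T" "y \<in> T"
    then obtain \<alpha> \<mu> a \<beta> \<nu> a' where x: "x = \<Phi> (\<alpha>, \<mu>, a, 0)" and t: "(\<alpha>, \<mu>, a, 0) \<in> data"
      and y: "y = \<Phi> (\<beta>, \<nu>, a', 0)" and t': "(\<beta>, \<nu>, a', 0) \<in> data"
      by (auto simp: T_def)
    have m: "datum_mult (\<alpha>, \<mu>, a, 0) (\<beta>, \<nu>, a', 0) = (\<beta> \<circ> \<alpha>, \<nu> * \<mu>, a * a', 0)"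
      by (simp add: datum_mult_def)
    show "x \<otimes>\<^bsub>A\<^esub> y \<in> T"
      using datum_mult_data[OF t t'] unfolding x y \<Phi>_mult[OF t t'] T_def m by blast
  qed
qed

text \<open>A datum with b = 0 might still translate y_1 by a multiple of x^d through its c.
  Membership in U forces \<mu> = a = 1, and then averaging gives c = 0.\<close>

lemma U_int_T: "dan_U d r \<sigma> \<inter> T \<subseteq> {\<one>\<^bsub>A\<^esub>}"
proof
  fix x assume "x \<in> dan_U d r \<sigma> \<inter> T"
  then obtain b \<alpha> \<mu> a where x: "x = \<Phi> (id, 1, 1, b)" and x': "x = \<Phi> (\<alpha>, \<mu>, a, 0)"
    and t: "(\<alpha>, \<mu>, a, 0) \<in> data" unfolding dan_U_def T_def by blast
  have eq: "1 = \<mu> \<and> 1 = a \<and> dan_ctilde d \<sigma> (id, 1, 1, b) = dan_ctilde d \<sigma> (\<alpha>, \<mu>, a, 0)"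
    using \<Phi>_eqD[OF unit_data t] x x' by metis
  then have "(\<alpha>, 1, 1, 0) \<in> data" using t by simp
  then have "dan_ctilde d \<sigma> (id, 1, 1, b) = 0"
    using eq dan_c_trivial by (auto simp: dan_ctilde_def)
  then have "b = 0" by (simp add: dan_ctilde_def dan_c_def)
  then show "x \<in> {\<one>\<^bsub>A\<^esub>}" using x by (simp add: A_one \<Phi>_one)
qed

text \<open>The left factor carries b / \<mu> because \<open>datum_mult\<close> multiplies its last
  component by the \<mu> of the right factor.\<close>

lemma decompose:
  assumes t: "(\<alpha>, \<mu>, a, b) \<in> data"
  shows "(\<alpha>, \<mu>, a, 0) \<in> data"
    and "\<Phi> (\<alpha>, \<mu>, a, b) = \<Phi> (id, 1, 1, smult (inverse \<mu>) b) \<otimes>\<^bsub>A\<^esub> \<Phi> (\<alpha>, \<mu>, a, 0)"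
proof -
  show t0: "(\<alpha>, \<mu>, a, 0) \<in> data" using t unfolding data_iff .
  show "\<Phi> (\<alpha>, \<mu>, a, b) = \<Phi> (id, 1, 1, smult (inverse \<mu>) b) \<otimes>\<^bsub>A\<^esub> \<Phi> (\<alpha>, \<mu>, a, 0)"
    unfolding \<Phi>_mult[OF unit_data t0] using data_basic(2)[OF t] by (simp add: datum_mult_def)
qed

text \<open>The classification treats a without exponent below d and a of exact order between 2 and
  d - 1. Taking the least exponent leaves order 1, where the datum is the unit; likewise \<alpha> =
  id gives \<mu> = 1.\<close>

lemma DP_data:
  assumes dp: "dubouloz_poloni d r \<sigma>" and d: "d \<ge> 2" and t: "(\<alpha>, \<mu>, a, b) \<in> data"
  shows "(id, 1, a, 0) \<in> data" "(\<alpha>, \<mu>, 1, 0) \<in> data"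
proof -
  note cl = bspec[OF conjunct2[OF dp[unfolded dubouloz_poloni_def]] t, unfolded prod.case]
  show "(id, 1, a, 0) \<in> data"
  proof (cases "\<forall>q\<in>{1..d-1}. a ^ q \<noteq> 1")
    case True
    then show ?thesis using cl by blast
  next
    case False
    then obtain q where q: "q \<in> {1..d-1}" "a ^ q = 1" by blast
    define q0 where "q0 = (LEAST q. 1 \<le> q \<and> a ^ q = 1)"
    have q0: "1 \<le> q0 \<and> a ^ q0 = 1" unfolding q0_def by (rule LeastI[of _ q]) (use q in simp)
    have le: "q0 \<le> q'" if "1 \<le> q' \<and> a ^ q' = 1" for q' unfolding q0_def using that by (rule Least_le)
    have prim: "primitive_root_of_unity q0 a"
      unfolding primitive_root_of_unity_def using q0 le by (metis atLeastLessThan_iff leD)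
    show ?thesis
    proof (cases "q0 = 1")
      case True
      then have "a = 1" using q0 by simp
      then show ?thesis using unit_data by simp
    next
      case False
      then have "q0 \<in> {2..d-1}" using q0 le[of q] q by auto
      then show ?thesis using cl prim by blast
    qed
  qed
  show "(\<alpha>, \<mu>, 1, 0) \<in> data"
  proof (cases "\<alpha> = id")
    case True
    then have "\<mu> = 1" using cl by blast
    then show ?thesis using True unit_data by simp
  next
    case False
    then show ?thesis using cl by blast
  qed
qed

lemma HS_eq_T:
  assumes dp: "dubouloz_poloni d r \<sigma>" and d: "d \<ge> 2"
  shows "dan_H d r \<sigma> <#>\<^bsub>A\<^esub> dan_S d r \<sigma> = T"
proof -
  have m: "\<Phi> (id, 1, a, 0) \<otimes>\<^bsub>A\<^esub> \<Phi> (\<alpha>, \<mu>, 1, 0) = \<Phi> (\<alpha>, \<mu>, a, 0) \<and> (\<alpha>, \<mu>, a, 0) \<in> data"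
    if "(id, 1, a, 0) \<in> data" "(\<alpha>, \<mu>, 1, 0) \<in> data" for a \<alpha> \<mu>
    using \<Phi>_mult[OF that] datum_mult_data[OF that] by (simp add: datum_mult_def)
  show ?thesis
  proof (intro equalityI subsetI)
    fix x assume "x \<in> dan_H d r \<sigma> <#>\<^bsub>A\<^esub> dan_S d r \<sigma>"
    then obtain a \<alpha> \<mu> where "(id, 1, a, 0) \<in> data" "(\<alpha>, \<mu>, 1, 0) \<in> data"
      "x = \<Phi> (id, 1, a, 0) \<otimes>\<^bsub>A\<^esub> \<Phi> (\<alpha>, \<mu>, 1, 0)"
      by (auto simp: set_mult_def dan_H_def dan_S_def)
    then show "x \<in> T" using m unfolding T_def by blast
  next
    fix x assume "x \<in> T"
    then obtain \<alpha> \<mu> a where x: "x = \<Phi> (\<alpha>, \<mu>, a, 0)" and t: "(\<alpha>, \<mu>, a, 0) \<in> data"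
      unfolding T_def by blast
    note D = DP_data[OF dp d t]
    have "x = \<Phi> (id, 1, a, 0) \<otimes>\<^bsub>A\<^esub> \<Phi> (\<alpha>, \<mu>, 1, 0)" using m[OF D] x by simp
    then show "x \<in> dan_H d r \<sigma> <#>\<^bsub>A\<^esub> dan_S d r \<sigma>"
      using D unfolding set_mult_def dan_H_def dan_S_def by blast
  qed
qed

lemma isotropy_semidirect:
  fixes f :: "'k poly"
  assumes dp: "dubouloz_poloni d r \<sigma>" and d: "d \<ge> 2"
  defines "U \<equiv> dan_U d r \<sigma>" and "K \<equiv> (dan_H d r \<sigma> <#>\<^bsub>A\<^esub> dan_S d r \<sigma>) \<inter> Iso f"
  shows "U \<lhd> A\<lparr>carrier := Iso f\<rparr>" "subgroup K (A\<lparr>carrier := Iso f\<rparr>)"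
    "(\<lambda>(u, h). u \<otimes>\<^bsub>A\<^esub> h) \<in> iso (conj_semidirect A U K) (A\<lparr>carrier := Iso f\<rparr>)"
proof -
  interpret group A by (rule group_A)
  have onto: "\<exists>t\<in>data. g = \<Phi> t" if "g \<in> Iso f" for g
  proof -
    have "carrier A = \<Phi> ` data"
      using conjunct1[OF dp[unfolded dubouloz_poloni_def]] by (simp only: bij_betw_def)
    then show ?thesis using IsoD(1)[OF that] by blast
  qed
  have K: "K = T \<inter> Iso f" unfolding K_def HS_eq_T[OF dp d] ..
  have KA: "subgroup K A" unfolding K by (rule subgroups_Inter_pair[OF subgroup_T subgroup_Iso])
  have UG: "U \<subseteq> Iso f" unfolding U_def by (rule U_subset_Iso)
  have UA: "subgroup U A" unfolding U_def by (rule subgroup_U)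
  show "subgroup K (A\<lparr>carrier := Iso f\<rparr>)"
    by (rule subgroup_incl[OF KA subgroup_Iso]) (simp add: K)
  show "U \<lhd> A\<lparr>carrier := Iso f\<rparr>"
  proof -
    interpret G: group "A\<lparr>carrier := Iso f\<rparr>" by (rule subgroup.subgroup_is_group[OF subgroup_Iso group_A])
    show ?thesis
      unfolding G.normal_inv_iff
    proof (intro conjI ballI)
      show "subgroup U (A\<lparr>carrier := Iso f\<rparr>)" by (rule subgroup_incl[OF UA subgroup_Iso UG])
      fix x u assume "x \<in> carrier (A\<lparr>carrier := Iso f\<rparr>)" and u: "u \<in> U"
      then have x: "x \<in> Iso f" by simp
      obtain t where t: "t \<in> data" "x = \<Phi> t" using onto[OF x] by blast
      have "inv\<^bsub>A\<lparr>carrier := Iso f\<rparr>\<^esub> x = inv\<^bsub>A\<^esub> x" by (rule m_inv_consistent[OF subgroup_Iso x])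
      then show "x \<otimes>\<^bsub>A\<lparr>carrier := Iso f\<rparr>\<^esub> u \<otimes>\<^bsub>A\<lparr>carrier := Iso f\<rparr>\<^esub> inv\<^bsub>A\<lparr>carrier := Iso f\<rparr>\<^esub> x \<in> U"
        using U_conj[OF t(1) u[unfolded U_def]] unfolding t(2) U_def by simp
    qed
  qed
  show "(\<lambda>(u, h). u \<otimes>\<^bsub>A\<^esub> h) \<in> iso (conj_semidirect A U K) (A\<lparr>carrier := Iso f\<rparr>)"
  proof (rule conj_semidirect_iso[OF group_A subgroup_Iso UA KA UG])
    show "K \<subseteq> Iso f" unfolding K by blast
    have "\<one>\<^bsub>A\<^esub> \<in> U \<inter> K" using subgroup.one_closed[OF UA] subgroup.one_closed[OF KA] by blast
    then show "U \<inter> K = {\<one>\<^bsub>A\<^esub>}" using U_int_T unfolding K U_def by blast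
  next
    fix g assume g: "g \<in> Iso f"
    obtain t where t': "t \<in> data" "g = \<Phi> t" using onto[OF g] by blast
    obtain \<alpha> \<mu> a b where t_eq: "t = (\<alpha>, \<mu>, a, b)" by (metis prod_cases4)
    note t = t'[unfolded t_eq]
    note D = decompose[OF t(1)]
    \<comment> \<open>The criterion for (\<alpha>, \<mu>, a, b) does not mention b, so removing the
      unipotent factor stays inside the isotropy group.\<close>
    have "\<Phi> (\<alpha>, \<mu>, a, 0) \<in> Iso f"
      using g unfolding t(2) isotropy_iff[OF t(1)] isotropy_iff[OF D(1)] .
    then have "\<Phi> (\<alpha>, \<mu>, a, 0) \<in> K" using D(1) unfolding K T_def by blast
    moreover have "\<Phi> (id, 1, 1, smult (inverse \<mu>) b) \<in> U"
      using unit_data unfolding U_def dan_U_def by blast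
    ultimately show "\<exists>n\<in>U. \<exists>k\<in>K. g = n \<otimes>\<^bsub>A\<^esub> k" using D(2) unfolding t(2) by blast
  qed
qed

end

section \<open>The criterion for f with prescribed exponents, and the theorem\<close>

lemma scale_poly_iff:
  fixes A :: "nat \<Rightarrow> 'k::field_char_0"
  assumes \<nu>: "inj_on \<nu> {0..l}" and A: "\<forall>i\<in>{0..l}. A i \<noteq> 0"
  defines "f \<equiv> (\<Sum>i=0..l. Polynomial.monom (A i) (\<nu> i))"
  shows "f \<noteq> 0"
    and "smult (a ^ d) (pcompose f [:0, a:]) = smult 1 f \<longleftrightarrow> a ^ Gcd ((\<lambda>i. d + \<nu> i) ` {0..l}) = 1"
proof -
  have cf: "coeff f m = (\<Sum>i=0..l. if \<nu> i = m then A i else 0)" for m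
    unfolding f_def coeff_sum coeff_monom ..
  \<comment> \<open>Distinct exponents prevent the terms of f from merging or cancelling.\<close>
  have cf1: "coeff f (\<nu> i) = A i" if "i \<in> {0..l}" for i
  proof -
    have "coeff f (\<nu> i) = (\<Sum>j=0..l. if j = i then A j else 0)"
      unfolding cf by (intro sum.cong refl) (use inj_onD[OF \<nu>] that in auto)
    then show ?thesis using that by simp
  qed
  have cf0: "coeff f m = 0" if "m \<notin> \<nu> ` {0..l}" for m
    unfolding cf by (intro sum.neutral) (use that in auto)
  show "f \<noteq> 0" using cf1[of 0] A by fastforce
  \<comment> \<open>Compared at X^m, the identity scales the coefficient by a^(d+m) and so
    constrains a exactly on the support of f. The shift by d in the gcd stems from D(y_1) =
    x^d.\<close>
  have "smult (a ^ d) (pcompose f [:0, a:]) = smult 1 f \<longleftrightarrow>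
      (\<forall>m. a ^ (d + m) * coeff f m = coeff f m)"
    by (simp add: poly_eq_iff coeff_pcompose_linear power_add mult.assoc)
  also have "\<dots> \<longleftrightarrow> (\<forall>i\<in>{0..l}. a ^ (d + \<nu> i) = 1)"
  proof (intro iffI ballI allI)
    fix i assume "\<forall>m. a ^ (d + m) * coeff f m = coeff f m" and i: "i \<in> {0..l}"
    then have "a ^ (d + \<nu> i) * A i = A i" using cf1[OF i] by metis
    then show "a ^ (d + \<nu> i) = 1" using A i by simp
  next
    fix m assume *: "\<forall>i\<in>{0..l}. a ^ (d + \<nu> i) = 1"
    show "a ^ (d + m) * coeff f m = coeff f m"
      by (cases "m \<in> \<nu> ` {0..l}") (use * cf0 in auto)
  qed
  also have "\<dots> \<longleftrightarrow> a ^ Gcd ((\<lambda>i. d + \<nu> i) ` {0..l}) = 1"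
    by (simp add: power_Gcd_eq_1_iff)
  finally show "smult (a ^ d) (pcompose f [:0, a:]) = smult 1 f \<longleftrightarrow>
      a ^ Gcd ((\<lambda>i. d + \<nu> i) ` {0..l}) = 1" .
qed

text \<open>In (ii) and (iii) the datum of a is required to exist, so that H_a is an automorphism.
  In (iv) this is required of all n-th roots of unity: the isotropic part of H consists of the H_a
  with a^n = 1 that occur, and would be smaller than Z_n if some were missing.\<close>

theorem theorem4p5:
  fixes d r l :: nat
    and \<sigma> :: "nat \<Rightarrow> 'k::field_char_0 poly"
    and A :: "nat \<Rightarrow> 'k" and \<nu> :: "nat \<Rightarrow> nat"
  assumes d: "d \<ge> 2" and r: "r \<ge> 2"
    and \<nu>: "inj_on \<nu> {0..l}"
    and A: "\<forall>i\<in>{0..l}. A i \<noteq> 0"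
  defines "P \<equiv> dan_P r \<sigma>"
    and "f \<equiv> (\<Sum>i=0..l. Polynomial.monom (A i) (\<nu> i))"
    and "n \<equiv> Gcd ((\<lambda>i. d + \<nu> i) ` {0..l})"
  defines "AutB \<equiv> dan_Aut d P"
    and "G \<equiv> dan_isotropy d P (dan_delta d P f)"
  defines "U \<equiv> dan_U d r \<sigma>" and "H \<equiv> dan_H d r \<sigma>" and "S \<equiv> dan_S d r \<sigma>"
  shows
    \<comment> \<open>(i)\<close>
    "(U \<subseteq> G \<and> U \<inter> G = U) \<and>
    \<comment> \<open>(ii)\<close>
     (\<forall>a. a \<noteq> 0 \<and> (\<forall>q\<in>{1..d-1}. a ^ q \<noteq> 1) \<and> (id, 1, a, 0) \<in> dan_data r \<sigma> \<longrightarrow>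
       (dan_Ha d r \<sigma> a \<in> G \<longleftrightarrow> a ^ n = 1 \<and> n \<ge> d)) \<and>
    \<comment> \<open>(iii)\<close>
     (\<forall>a. \<forall>q\<^sub>0\<in>{2..d-1}. a \<noteq> 0 \<and> primitive_root_of_unity q\<^sub>0 a \<and> (id, 1, a, 0) \<in> dan_data r \<sigma> \<longrightarrow>
       (dan_Ha d r \<sigma> a \<in> G \<longleftrightarrow> q\<^sub>0 dvd n)) \<and>
    \<comment> \<open>(iv)\<close>
     ((\<forall>p :: 'k poly. Polynomial.degree p > 0 \<longrightarrow> (\<exists>z. poly p z = 0)) \<and>
      (\<forall>a. a ^ n = 1 \<longrightarrow> (id, 1, a, 0) \<in> dan_data r \<sigma>) \<longrightarrow>
       AutB\<lparr>carrier := H \<inter> G\<rparr> \<cong> integer_mod_group n \<and>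
       (n \<ge> d \<longrightarrow> {g \<in> H \<inter> G. generate AutB {g} = H \<inter> G} =
          {dan_Ha d r \<sigma> a | a. (\<forall>q\<in>{1..d-1}. a ^ q \<noteq> 1) \<and> primitive_root_of_unity n a}) \<and>
       (\<not> n \<ge> d \<longrightarrow> {g \<in> H \<inter> G. generate AutB {g} = H \<inter> G} =
          {dan_Ha d r \<sigma> a | a. primitive_root_of_unity n a})) \<and>
    \<comment> \<open>(v)\<close>
     S \<inter> G = {\<one>\<^bsub>AutB\<^esub>} \<and>
    \<comment> \<open>(vi)\<close>
     (dubouloz_poloni d r \<sigma> \<longrightarrow>
       U \<lhd> AutB\<lparr>carrier := G\<rparr> \<and>
       subgroup ((H <#>\<^bsub>AutB\<^esub> S) \<inter> G) (AutB\<lparr>carrier := G\<rparr>) \<and>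
       (\<lambda>(u, h). u \<otimes>\<^bsub>AutB\<^esub> h) \<in>
         iso (conj_semidirect AutB U ((H <#>\<^bsub>AutB\<^esub> S) \<inter> G)) (AutB\<lparr>carrier := G\<rparr>))"
proof -
  interpret danielewski d r \<sigma> by unfold_locales (use r in simp)
  note f0 = scale_poly_iff(1)[OF \<nu> A, folded f_def]
    and f_iff = scale_poly_iff(2)[OF \<nu> A, of _ d, folded f_def n_def]
  \<comment> \<open>For n = 0 the group \<open>integer_mod_group n\<close> would be infinite; n is
    positive because it divides d + \<nu>(0) > 0.\<close>
  have n1: "n \<ge> 1"
  proof -
    have "n dvd d + \<nu> 0" unfolding n_def by (rule Gcd_dvd) simp
    then show ?thesis using d by (cases n) auto
  qed
  have Ha_iff: "dan_Ha d r \<sigma> a \<in> G \<longleftrightarrow> a ^ n = 1" if "(id, 1, a, 0) \<in> dan_data r \<sigma>" for a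
    unfolding G_def P_def dan_Ha_def isotropy_iff[OF that] f_iff ..
  have i: "U \<subseteq> G" unfolding U_def G_def P_def by (rule U_subset_Iso)
  have ii: "dan_Ha d r \<sigma> a \<in> G \<longleftrightarrow> a ^ n = 1 \<and> n \<ge> d"
    if q: "\<forall>q\<in>{1..d-1}. a ^ q \<noteq> 1" and t: "(id, 1, a, 0) \<in> dan_data r \<sigma>" for a
  proof -
    \<comment> \<open>If n were below d, it would itself be one of the exponents excluded for
      a.\<close>
    have "n \<ge> d" if "a ^ n = 1"
    proof (rule ccontr)
      assume "\<not> n \<ge> d"
      then have "n \<in> {1..d-1}" using n1 by auto
      then show False using q that by blast
    qed
    then show ?thesis using Ha_iff[OF t] by blast
  qed
  have iv: "AutB\<lparr>carrier := H \<inter> G\<rparr> \<cong> integer_mod_group n \<and>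
      {g \<in> H \<inter> G. generate AutB {g} = H \<inter> G} = {dan_Ha d r \<sigma> a | a. primitive_root_of_unity n a}"
    if closed: "\<forall>p :: 'k poly. Polynomial.degree p > 0 \<longrightarrow> (\<exists>z. poly p z = 0)"
      and t: "\<forall>a. a ^ n = 1 \<longrightarrow> (id, 1, a, 0) \<in> dan_data r \<sigma>"
  proof -
    obtain w :: 'k where w: "primitive_root_of_unity n w"
      using primitive_root_exists[OF _ n1] closed by blast
    have K: "H \<inter> G = {dan_Ha d r \<sigma> a | a. a ^ n = 1}"
    proof (intro equalityI subsetI)
      fix g assume g: "g \<in> H \<inter> G"
      then obtain a where "g = dan_Ha d r \<sigma> a" "(id, 1, a, 0) \<in> dan_data r \<sigma>"
        unfolding H_def dan_H_def dan_Ha_def by blast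
      then show "g \<in> {dan_Ha d r \<sigma> a | a. a ^ n = 1}" using g Ha_iff by blast
    next
      fix g assume "g \<in> {dan_Ha d r \<sigma> a | a. a ^ n = 1}"
      then obtain a where g: "g = dan_Ha d r \<sigma> a" and a: "a ^ n = 1" by blast
      then have ta: "(id, 1, a, 0) \<in> dan_data r \<sigma>" using t by blast
      then have "g \<in> H" unfolding g H_def dan_H_def dan_Ha_def by blast
      then show "g \<in> H \<inter> G" using Ha_iff[OF ta] a g by blast
    qed
    interpret group "dan_Aut d (dan_P r \<sigma>)" by (rule group_A)
    have sub: "subgroup (H \<inter> G) (dan_Aut d (dan_P r \<sigma>))"
      unfolding H_def G_def P_def by (rule subgroups_Inter_pair[OF subgroup_H subgroup_Iso])
    show ?thesis
      unfolding AutB_def P_def using cyclic_torus[OF n1 w t[rule_format] K sub] by blast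
  qed
  \<comment> \<open>For n \<ge> d the exponents 1 to d - 1 lie below n, so primitivity already
    excludes them.\<close>
  have prim: "(\<forall>q\<in>{1..d-1}. a ^ q \<noteq> 1) \<and> primitive_root_of_unity n a \<longleftrightarrow> primitive_root_of_unity n a"
    if "n \<ge> d" for a :: 'k
    using that by (auto simp: primitive_root_of_unity_def)
  show ?thesis
  proof (intro conjI)
    show "U \<subseteq> G" by (rule i)
    show "U \<inter> G = U" using i by blast
    show "\<forall>a. a \<noteq> 0 \<and> (\<forall>q\<in>{1..d-1}. a ^ q \<noteq> 1) \<and> (id, 1, a, 0) \<in> dan_data r \<sigma> \<longrightarrow>
        (dan_Ha d r \<sigma> a \<in> G \<longleftrightarrow> a ^ n = 1 \<and> n \<ge> d)"
      using ii by blast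
    show "\<forall>a. \<forall>q\<^sub>0\<in>{2..d-1}. a \<noteq> 0 \<and> primitive_root_of_unity q\<^sub>0 a \<and> (id, 1, a, 0) \<in> dan_data r \<sigma> \<longrightarrow>
        (dan_Ha d r \<sigma> a \<in> G \<longleftrightarrow> q\<^sub>0 dvd n)"
      using Ha_iff primitive_root_power_eq_1_iff by blast
    show "(\<forall>p :: 'k poly. Polynomial.degree p > 0 \<longrightarrow> (\<exists>z. poly p z = 0)) \<and>
      (\<forall>a. a ^ n = 1 \<longrightarrow> (id, 1, a, 0) \<in> dan_data r \<sigma>) \<longrightarrow>
       AutB\<lparr>carrier := H \<inter> G\<rparr> \<cong> integer_mod_group n \<and>
       (n \<ge> d \<longrightarrow> {g \<in> H \<inter> G. generate AutB {g} = H \<inter> G} =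
          {dan_Ha d r \<sigma> a | a. (\<forall>q\<in>{1..d-1}. a ^ q \<noteq> 1) \<and> primitive_root_of_unity n a}) \<and>
       (\<not> n \<ge> d \<longrightarrow> {g \<in> H \<inter> G. generate AutB {g} = H \<inter> G} =
          {dan_Ha d r \<sigma> a | a. primitive_root_of_unity n a})"
      (is "?hyp \<longrightarrow> ?iso \<and> (_ \<longrightarrow> ?gen = _) \<and> _")
    proof (intro impI conjI)
      assume h: ?hyp
      note iv' = iv[OF conjunct1[OF h] conjunct2[OF h]]
      show ?iso by (rule conjunct1[OF iv'])
      show "?gen = {dan_Ha d r \<sigma> a | a. primitive_root_of_unity n a}" by (rule conjunct2[OF iv'])
      show "?gen = {dan_Ha d r \<sigma> a | a. (\<forall>q\<in>{1..d-1}. a ^ q \<noteq> 1) \<and> primitive_root_of_unity n a}"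
        if "n \<ge> d"
        unfolding prim[OF that] by (rule conjunct2[OF iv'])
    qed
    show "S \<inter> G = {\<one>\<^bsub>AutB\<^esub>}"
      unfolding S_def G_def AutB_def P_def by (rule S_Iso[OF f0])
    show "dubouloz_poloni d r \<sigma> \<longrightarrow>
       U \<lhd> AutB\<lparr>carrier := G\<rparr> \<and>
       subgroup ((H <#>\<^bsub>AutB\<^esub> S) \<inter> G) (AutB\<lparr>carrier := G\<rparr>) \<and>
       (\<lambda>(u, h). u \<otimes>\<^bsub>AutB\<^esub> h) \<in>
         iso (conj_semidirect AutB U ((H <#>\<^bsub>AutB\<^esub> S) \<inter> G)) (AutB\<lparr>carrier := G\<rparr>)"
      unfolding U_def H_def S_def G_def AutB_def P_def
      using isotropy_semidirect[OF _ d] by blast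
  qed
qed

end
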